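(* There exist absolute constants $0<c<C$ such that for every $p=p(n)$ with $n^{-1}\le p\le 1-n^{-0.99}$, with probability tending to $1$ as $n\to\infty$ the minimum dimension $d$ such that $G=G(n,p)$ has an orthogonal representation in $\mathbb{R}^d$ satisfies $$c\,\frac{n\log(1/p)}{\log n}\le d\le C\,\frac{n\log(1/p)}{\log n}.$$
   Context: An orthogonal representation of dimension $d$ of a graph $G$ on $[n]$ is an assignment of nonzero vectors $v_1,\dots,v_n\in\mathbb{R}^d$ to the vertices such that $\langle v_i,v_j\rangle=0$ whenever $i\ne j$ are nonadjacent in $G$. $G(n,p)$ denotes the binomial random graph on $[n]$ in which each pair is an edge independently with probability $p$. *)

theory Defs
  imports "HOL-Probability.Probability"
begin

definition gnp :: "nat \<Rightarrow> real \<Rightarrow> nat set set pmf" where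
  "gnp n p = map_pmf (\<lambda>f. {{i, j} | i j. i < j \<and> j < n \<and> f (i, j)})
      (Pi_pmf {(i, j). i < j \<and> j < n} False (\<lambda>_. bernoulli_pmf p))"

text \<open>An orthogonal representation of dimension d: vectors in R^d are represented by
  functions nat => real of which only the coordinates 0..<d matter.\<close>

definition orth_rep :: "nat \<Rightarrow> nat set set \<Rightarrow> nat \<Rightarrow> (nat \<Rightarrow> nat \<Rightarrow> real) \<Rightarrow> bool" where
  "orth_rep n E d v \<longleftrightarrow>
     (\<forall>i<n. \<exists>k<d. v i k \<noteq> 0) \<and>
     (\<forall>i<n. \<forall>j<n. i \<noteq> j \<and> {i, j} \<notin> E \<longrightarrow> (\<Sum>k<d. v i k * v j k) = 0)"

definition orth_dim :: "nat \<Rightarrow> nat set set \<Rightarrow> nat" where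
  "orth_dim n E = (LEAST d. \<exists>v. orth_rep n E d v)"

end

theory Submission
  imports Defs "HOL-Library.Function_Algebras" "HOL-Real_Asymp.Real_Asymp"
    "Jordan_Normal_Form.Determinant"
begin

text \<open>
  Upper bound: a partition of the vertices into \<open>K\<close> cliques gives an orthogonal representation by
  standard basis vectors. Adding the vertices one at a time, a new vertex fits into none of the \<open>K\<close>
  cliques only with probability \<open>\<Prod>a. (1 - p ^ s a) \<le> exp (- K * p powr (n / K))\<close>, where \<open>s a\<close> are the
  sizes of the cliques.

  Lower bound (after Golovnev, Regev and Weinstein, and Alon, Balla, Gishboliner, Mond and Mousset):
  among the principal submatrices of the Gram matrix of a representation in dimension \<open>d\<close>, choose
  one minimising rank divided by size. Its columns contain a basis that carries at most a fraction
  \<open>d / n\<close> of its \<open>s\<close> nonzero entries, so its zero pattern is the zero pattern of polynomials in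
  \<open>s * d / n\<close> variables. There are at most \<open>n ^ O(s * d / n)\<close> such patterns, each is contained in the
  random graph with probability \<open>p ^ \<Omega>(s)\<close>, and the union bound applies when
  \<open>d \<le> c * n * ln (1 / p) / ln n\<close>.
\<close>

section \<open>Zero patterns of polynomials\<close>

definition fscale :: "real \<Rightarrow> ('a \<Rightarrow> real) \<Rightarrow> 'a \<Rightarrow> real" where
  "fscale c f = (\<lambda>x. c * f x)"

lemma fscale_apply: "fscale c f x = c * f x"
  by (simp add: fscale_def)

interpretation fs: vector_space "fscale :: real \<Rightarrow> ('a \<Rightarrow> real) \<Rightarrow> 'a \<Rightarrow> real"
  by unfold_locales (auto simp: fun_eq_iff fscale_apply algebra_simps)

lemma sum_fun_apply: "(\<Sum>i\<in>A. f i) x = (\<Sum>i\<in>A. f i x)"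
  for f :: "'i \<Rightarrow> 'a \<Rightarrow> real"
  by (induction A rule: infinite_finite_induct) auto

text \<open>\<open>D\<close> bounds the exponent of each variable separately, not the total degree.
  This makes the count of monomials a plain power, and under multiplication the bounds just
  add.\<close>

definition monomials :: "'v set \<Rightarrow> nat \<Rightarrow> (('v \<Rightarrow> real) \<Rightarrow> real) set" where
  "monomials V D = (\<lambda>e u. \<Prod>x\<in>V. u x ^ e x) ` (V \<rightarrow>\<^sub>E {..D})"

abbreviation poly_fun :: "'v set \<Rightarrow> nat \<Rightarrow> (('v \<Rightarrow> real) \<Rightarrow> real) \<Rightarrow> bool" where
  "poly_fun V D f \<equiv> f \<in> fs.span (monomials V D)"

lemma finite_monomials: "finite V \<Longrightarrow> finite (monomials V D)"
  unfolding monomials_def by (intro finite_imageI finite_PiE) auto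

lemma card_monomials_le:
  assumes "finite V"
  shows "card (monomials V D) \<le> (D + 1) ^ card V"
proof -
  have "card (monomials V D) \<le> card (V \<rightarrow>\<^sub>E {..D})"
    unfolding monomials_def by (intro card_image_le finite_PiE) (auto simp: assms)
  also have "\<dots> = (D + 1) ^ card V"
    by (simp add: card_PiE assms)
  finally show ?thesis .
qed

lemma monomialI:
  assumes "\<And>x. x \<in> V \<Longrightarrow> e x \<le> D"
  shows "(\<lambda>u. \<Prod>x\<in>V. u x ^ e x) \<in> monomials V D"
proof -
  have "(\<lambda>u::'a \<Rightarrow> real. \<Prod>x\<in>V. u x ^ e x) = (\<lambda>u. \<Prod>x\<in>V. u x ^ restrict e V x)"
    by (intro ext prod.cong) auto
  then show ?thesis
    unfolding monomials_def using assms by (intro image_eqI[where x = "restrict e V"]) auto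
qed

lemma poly_fun_mono:
  assumes "D \<le> D'" "poly_fun V D f"
  shows "poly_fun V D' f"
proof -
  have "monomials V D \<subseteq> monomials V D'"
    unfolding monomials_def using assms(1) by (intro image_mono PiE_mono) auto
  then show ?thesis
    using assms(2) fs.span_mono by blast
qed

lemma poly_fun_const: "poly_fun V D (\<lambda>u. c)"
proof -
  have "(\<lambda>u::'a \<Rightarrow> real. 1) \<in> monomials V D"
    using monomialI[of V "\<lambda>_. 0" D] by simp
  then have "fscale c (\<lambda>u. 1) \<in> fs.span (monomials V D)"
    by (intro fs.span_scale fs.span_base)
  then show ?thesis
    by (simp add: fscale_def)
qed

lemma poly_fun_var:
  assumes "finite V" "x \<in> V"
  shows "poly_fun V 1 (\<lambda>u. u x)"
proof -
  have "(\<lambda>u::'a \<Rightarrow> real. u x) = (\<lambda>u. \<Prod>y\<in>V. u y ^ (if y = x then 1 else 0))"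
  proof
    fix u :: "'a \<Rightarrow> real"
    have "(\<Prod>y\<in>V. u y ^ (if y = x then 1 else 0)) = (\<Prod>y\<in>V. if y = x then u y else 1)"
      by (intro prod.cong) auto
    also have "\<dots> = u x"
      using assms by simp
    finally show "u x = (\<Prod>y\<in>V. u y ^ (if y = x then 1 else 0))" ..
  qed
  also have "\<dots> \<in> monomials V 1"
    by (rule monomialI) auto
  finally show ?thesis
    by (rule fs.span_base)
qed

lemma poly_fun_sum:
  assumes "\<And>i. i \<in> I \<Longrightarrow> poly_fun V D (f i)"
  shows "poly_fun V D (\<lambda>u. \<Sum>i\<in>I. f i u)"
proof -
  have "(\<lambda>u. \<Sum>i\<in>I. f i u) = (\<Sum>i\<in>I. f i)"
    by (simp add: fun_eq_iff sum_fun_apply)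
  then show ?thesis
    using fs.span_sum[of I f "monomials V D"] assms by simp
qed

lemma poly_fun_cmult: "poly_fun V D f \<Longrightarrow> poly_fun V D (\<lambda>u. c * f u)"
  using fs.span_scale[of f "monomials V D" c] by (simp add: fscale_def)

text \<open>Two monomials multiply to a monomial with added exponents. The product is bilinear, so
  one span induction in each factor carries this over to all polynomials.\<close>

lemma poly_fun_mult:
  assumes f: "poly_fun V D f" and g: "poly_fun V D' g"
  shows "poly_fun V (D + D') (\<lambda>u. f u * g u)"
proof -
  have mono: "poly_fun V (D + D') (\<lambda>u. m u * g u)" if m: "m \<in> monomials V D" for m
    using g
  proof (induction rule: fs.span_induct_alt)
    case base
    show ?case using poly_fun_const[where c = 0] by (simp add: zero_fun_def)
  next
    case (step c m' h)
    from m obtain e where e: "m = (\<lambda>u. \<Prod>x\<in>V. u x ^ e x)" "\<And>x. x \<in> V \<Longrightarrow> e x \<le> D"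
      by (auto simp: monomials_def)
    from step(1) obtain e' where e': "m' = (\<lambda>u. \<Prod>x\<in>V. u x ^ e' x)" "\<And>x. x \<in> V \<Longrightarrow> e' x \<le> D'"
      by (auto simp: monomials_def)
    have "(\<lambda>u. \<Prod>x\<in>V. u x ^ (e x + e' x)) \<in> monomials V (D + D')"
      using e(2) e'(2) by (intro monomialI add_mono)
    then have "poly_fun V (D + D') (\<lambda>u. m u * m' u)"
      by (auto simp: e(1) e'(1) power_add prod.distrib intro: fs.span_base)
    then have "fscale c (\<lambda>u. m u * m' u) + (\<lambda>u. m u * h u) \<in> fs.span (monomials V (D + D'))"
      using step by (intro fs.span_add fs.span_scale)
    also have "fscale c (\<lambda>u. m u * m' u) + (\<lambda>u. m u * h u) = (\<lambda>u. m u * (fscale c m' + h) u)"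
      by (simp add: fun_eq_iff fscale_apply algebra_simps)
    finally show ?case .
  qed
  show ?thesis
    using f
  proof (induction rule: fs.span_induct_alt)
    case base
    show ?case using poly_fun_const[where c = 0] by (simp add: zero_fun_def)
  next
    case (step c m h)
    then have "fscale c (\<lambda>u. m u * g u) + (\<lambda>u. h u * g u) \<in> fs.span (monomials V (D + D'))"
      by (intro fs.span_add fs.span_scale) (auto intro: mono)
    also have "fscale c (\<lambda>u. m u * g u) + (\<lambda>u. h u * g u) = (\<lambda>u. (fscale c m + h) u * g u)"
      by (simp add: fun_eq_iff fscale_apply algebra_simps)
    finally show ?case .
  qed
qed

lemma poly_fun_prod:
  assumes "finite I" "\<And>i. i \<in> I \<Longrightarrow> poly_fun V D (f i)"
  shows "poly_fun V (card I * D) (\<lambda>u. \<Prod>i\<in>I. f i u)"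
  using assms
proof (induction I rule: finite_induct)
  case empty
  show ?case using poly_fun_const[where c = 1] by simp
next
  case (insert i I)
  then show ?case
    using poly_fun_mult[of "f i" V D "\<lambda>u. \<Prod>i\<in>I. f i u" "card I * D"] by simp
qed

text \<open>In the Leibniz expansion every summand is a sign times a product of \<open>k\<close>
  entries, each of degree at most 1 in every variable.\<close>

lemma poly_fun_det:
  assumes "\<And>r c. r < k \<Longrightarrow> c < k \<Longrightarrow> poly_fun V 1 (\<lambda>u. A u r c)"
  shows "poly_fun V k (\<lambda>u. det (mat k k (\<lambda>(r, c). A u r c)))"
proof -
  have "det (mat k k (\<lambda>(r, c). A u r c)) =
      (\<Sum>p\<in>{p. p permutes {0..<k}}. signof p * (\<Prod>i = 0..<k. A u i (p i)))" for u
  proof -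
    have "p i < k" if "p permutes {0..<k}" "i < k" for p i
      using permutes_in_image[OF that(1), of i] that(2) by simp
    then show ?thesis
      by (subst det_def'[of _ k]) (auto intro!: sum.cong prod.cong)
  qed
  moreover have "poly_fun V (card {0..<k} * 1) (\<lambda>u. \<Prod>i = 0..<k. A u i (p i))"
    if "p permutes {0..<k}" for p
    using permutes_in_image[OF that] assms by (intro poly_fun_prod) auto
  ultimately show ?thesis
    by (auto intro!: poly_fun_sum poly_fun_cmult)
qed

text \<open>The argument of Ronyai, Babai and Ganapathy: for each pattern \<open>A\<close> the product of the
  \<open>f j\<close> with \<open>j \<in> A\<close> is nonzero at a witness of \<open>A'\<close> iff \<open>A \<subseteq> A'\<close>, so these products are
  linearly independent.\<close>

lemma card_zero_patterns_le:
  assumes "finite V" "finite J" and f: "\<And>j. j \<in> J \<Longrightarrow> poly_fun V D (f j)"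
  shows "card (range (\<lambda>u. {j\<in>J. f j u \<noteq> 0})) \<le> (card J * D + 1) ^ card V"
proof -
  define Z where "Z u = {j\<in>J. f j u \<noteq> 0}" for u
  define \<Z> where "\<Z> = range Z"
  define w where "w A = (SOME u. Z u = A)" for A
  define g where "g A = (\<lambda>u. \<Prod>j\<in>A. f j u)" for A
  have sub: "A \<subseteq> J" if "A \<in> \<Z>" for A
    using that \<open>finite J\<close> by (auto simp: \<Z>_def Z_def)
  have fin: "finite \<Z>"
    using \<open>finite J\<close> by (auto simp: \<Z>_def Z_def intro: finite_subset[of _ "Pow J"])
  have w: "Z (w A) = A" if "A \<in> \<Z>" for A
    using that unfolding w_def \<Z>_def by (metis (mono_tags) imageE someI)
  have nz: "g A (w A') \<noteq> 0 \<longleftrightarrow> A \<subseteq> A'" if "A \<in> \<Z>" "A' \<in> \<Z>" for A A'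
  proof -
    have "g A (w A') \<noteq> 0 \<longleftrightarrow> (\<forall>j\<in>A. f j (w A') \<noteq> 0)"
      using sub[OF that(1)] \<open>finite J\<close> by (auto simp: g_def finite_subset)
    also have "\<dots> \<longleftrightarrow> A \<subseteq> Z (w A')"
      using sub[OF that(1)] by (auto simp: Z_def)
    finally show ?thesis
      using w[OF that(2)] by simp
  qed
  have inj: "inj_on g \<Z>"
    by (rule inj_onI) (metis nz order_refl subset_antisym)
  have ind: "fs.independent (g ` \<Z>)"
  proof
    assume "fs.dependent (g ` \<Z>)"
    then obtain c where c: "\<exists>h\<in>g ` \<Z>. c h \<noteq> 0" "(\<Sum>h\<in>g ` \<Z>. fscale (c h) h) = 0"
      using fin by (auto simp: fs.dependent_finite)
    then have sum0: "(\<Sum>A\<in>\<Z>. fscale (c (g A)) (g A)) = 0"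
      using sum.reindex[OF inj, of "\<lambda>h. fscale (c h) h"] by (simp add: o_def)
    define \<N> where "\<N> = {A\<in>\<Z>. c (g A) \<noteq> 0}"
    have "finite \<N>" "\<N> \<noteq> {}"
      using c(1) fin by (auto simp: \<N>_def)
    \<comment> \<open>At the witness of \<open>A\<close> only the products indexed by subsets of
      \<open>A\<close> survive. Minimality among the sets with nonzero coefficient leaves
      \<open>A\<close> alone, so the relation fails there.\<close>
    then obtain A where A: "A \<in> \<N>" and min: "\<And>B. B \<in> \<N> \<Longrightarrow> B \<subseteq> A \<Longrightarrow> A = B"
      using finite_has_minimal by metis
    have "0 = (\<Sum>B\<in>\<Z>. c (g B) * g B (w A))"
      using fun_cong[OF sum0, of "w A"] by (simp add: sum_fun_apply fscale_apply)
    also have "\<dots> = (\<Sum>B\<in>{A}. c (g B) * g B (w A))"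
    proof (rule sum.mono_neutral_right)
      show "\<forall>B\<in>\<Z> - {A}. c (g B) * g B (w A) = 0"
        using nz min A by (auto simp: \<N>_def) blast
    qed (use fin A in \<open>auto simp: \<N>_def\<close>)
    also have "\<dots> \<noteq> 0"
      using A nz by (auto simp: \<N>_def)
    finally show False by simp
  qed
  have "g ` \<Z> \<subseteq> fs.span (monomials V (card J * D))"
  proof
    fix h assume "h \<in> g ` \<Z>"
    then obtain A where A: "A \<in> \<Z>" "h = g A" by blast
    have "poly_fun V (card A * D) (g A)"
      unfolding g_def using sub[OF A(1)] \<open>finite J\<close> f by (intro poly_fun_prod) (auto simp: finite_subset)
    then show "h \<in> fs.span (monomials V (card J * D))"
      using poly_fun_mono[of "card A * D" "card J * D"] A(2) sub[OF A(1)] \<open>finite J\<close>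
      by (simp add: card_mono)
  qed
  then have "card (g ` \<Z>) \<le> card (monomials V (card J * D))"
    using fs.independent_span_bound[OF finite_monomials[OF \<open>finite V\<close>] ind] by blast
  also have "\<dots> \<le> (card J * D + 1) ^ card V"
    by (rule card_monomials_le) fact
  finally show ?thesis
    unfolding card_image[OF inj] by (simp add: \<Z>_def Z_def)
qed

section \<open>Gram matrices\<close>

definition dot :: "nat \<Rightarrow> (nat \<Rightarrow> real) \<Rightarrow> (nat \<Rightarrow> real) \<Rightarrow> real" where
  "dot d x y = (\<Sum>k<d. x k * y k)"

lemma dot_commute: "dot d x y = dot d y x"
  by (simp add: dot_def mult.commute)

lemma dot_add_right: "dot d x (y + z) = dot d x y + dot d x z"
  by (simp add: dot_def algebra_simps sum.distrib)

lemma dot_fscale_right: "dot d x (fscale c y) = c * dot d x y"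
  by (simp add: dot_def fscale_apply sum_distrib_left mult_ac)

lemma dot_zero_right [simp]: "dot d x 0 = 0"
  by (simp add: dot_def)

lemma dot_sum_right: "dot d x (\<Sum>i\<in>I. f i) = (\<Sum>i\<in>I. dot d x (f i))"
  unfolding dot_def sum_fun_apply sum_distrib_left by (rule sum.swap)

lemma dot_span_eq_0:
  assumes "y \<in> fs.span A" "\<And>a. a \<in> A \<Longrightarrow> dot d x a = 0"
  shows "dot d x y = 0"
proof -
  have "fs.subspace {y. dot d x y = 0}"
    by (auto simp: fs.subspace_def dot_add_right dot_fscale_right)
  then show ?thesis
    using fs.span_minimal[of A "{y. dot d x y = 0}"] assms by blast
qed

text \<open>A copy of \<open>d\<close>-dimensional space inside the functions on the naturals. On it
  \<open>dot d\<close> is positive definite, which fails for functions that are nonzero only from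
  coordinate \<open>d\<close> on.\<close>

definition supported :: "nat \<Rightarrow> (nat \<Rightarrow> real) set" where
  "supported d = {x. \<forall>k\<ge>d. x k = 0}"

lemma subspace_supported: "fs.subspace (supported d)"
  by (auto simp: fs.subspace_def supported_def fscale_apply)

lemma supported_dot_self_eq_0:
  assumes "x \<in> supported d"
  shows "dot d x x = 0 \<longleftrightarrow> x = 0"
proof
  assume "dot d x x = 0"
  then have "x k = 0" if "k < d" for k
    using that by (simp add: dot_def sum_nonneg_eq_0_iff)
  then show "x = 0"
    using assms by (auto simp: fun_eq_iff supported_def not_less[symmetric])
qed simp

lemma independent_card_le_supported:
  assumes "fs.independent A" "A \<subseteq> supported d"
  shows "finite A" "card A \<le> d"
proof -
  define e :: "nat \<Rightarrow> nat \<Rightarrow> real" where "e k = (\<lambda>l. if l = k then 1 else 0)" for k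
  have "x \<in> fs.span (e ` {..<d})" if "x \<in> supported d" for x
  proof -
    have "x l = (\<Sum>k<d. fscale (x k) (e k)) l" for l
      using that by (auto simp: sum_fun_apply fscale_apply e_def supported_def if_distrib cong: if_cong)
    then have "x = (\<Sum>k<d. fscale (x k) (e k))"
      by blast
    then show ?thesis
      by (rule ssubst) (intro fs.span_sum fs.span_scale fs.span_base, auto)
  qed
  with assms have "A \<subseteq> fs.span (e ` {..<d})"
    by blast
  then have *: "finite A \<and> card A \<le> card (e ` {..<d})"
    using assms by (intro fs.independent_span_bound) auto
  then show "finite A" by blast
  show "card A \<le> d"
    using * card_image_le[of "{..<d}" e] by simp
qed

section \<open>Independent indexed families and bases of small weight\<close>

definition indep_on :: "('i \<Rightarrow> 'a \<Rightarrow> real) \<Rightarrow> 'i set \<Rightarrow> bool" where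
  "indep_on v B \<longleftrightarrow> inj_on v B \<and> fs.independent (v ` B)"

lemma indep_on_insert:
  assumes "indep_on v B" "v i \<notin> fs.span (v ` B)"
  shows "indep_on v (insert i B)"
proof -
  have "v i \<notin> v ` B"
    using assms(2) fs.span_base[of "v i" "v ` B"] by (rule contrapos_nn)
  moreover from assms have "fs.independent (insert (v i) (v ` B))"
    unfolding indep_on_def by (intro fs.independent_insertI) simp_all
  moreover have "inj_on v B"
    using assms(1) by (simp add: indep_on_def)
  ultimately show ?thesis
    unfolding indep_on_def image_insert inj_on_insert by blast
qed

text \<open>Greedy extension, one index at a time. It works with indices rather than vectors because
  the weights in \<open>light_basis\<close> belong to indices.\<close>

lemma indep_on_extend:
  assumes "finite T" "indep_on v B" "B \<subseteq> T"
  obtains B' where "B \<subseteq> B'" "B' \<subseteq> T" "indep_on v B'" "v ` T \<subseteq> fs.span (v ` B')"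
proof -
  have "\<exists>B'. B \<subseteq> B' \<and> B' \<subseteq> B \<union> U \<and> indep_on v B' \<and> v ` (B \<union> U) \<subseteq> fs.span (v ` B')"
    if "finite U" for U
    using that
  proof (induction U rule: finite_induct)
    case empty
    show ?case
      using assms(2) by (intro exI[of _ B]) (auto intro: fs.span_base)
  next
    case (insert i U)
    then obtain B' where B': "B \<subseteq> B'" "B' \<subseteq> B \<union> U" "indep_on v B'"
      "v ` (B \<union> U) \<subseteq> fs.span (v ` B')" by blast
    show ?case
    proof (cases "v i \<in> fs.span (v ` B')")
      case True
      then show ?thesis using B' by (intro exI[of _ B']) auto
    next
      case False
      have "fs.span (v ` B') \<subseteq> fs.span (v ` insert i B')"
        by (intro fs.span_mono) auto
      moreover have "v i \<in> fs.span (v ` insert i B')"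
        by (intro fs.span_base) auto
      ultimately show ?thesis
        using B' indep_on_insert[OF B'(3) False] by (intro exI[of _ "insert i B'"]) auto
    qed
  qed
  from this[of "T - B"] show ?thesis
    using assms that by (auto simp: Un_absorb1)
qed

lemma indep_on_card_le_dim:
  assumes "finite S" "B \<subseteq> S" "indep_on v B"
  shows "card B \<le> fs.dim (v ` S)"
proof -
  obtain C where C: "C \<subseteq> v ` S" "fs.independent C" "v ` S \<subseteq> fs.span C" "card C = fs.dim (v ` S)"
    using fs.basis_exists by metis
  have "card (v ` B) \<le> card C"
    using assms C finite_subset[OF C(1)] by (intro conjunct2[OF fs.independent_span_bound]) (auto simp: indep_on_def)
  then show ?thesis
    using assms(3) C(4) by (simp add: card_image indep_on_def)
qed

lemma dim_le_card_spanning: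
  assumes "finite B" "v ` S \<subseteq> fs.span (v ` B)"
  shows "fs.dim (v ` S) \<le> card B"
  using fs.dim_le_card[OF assms(2)] assms(1) card_image_le[OF assms(1), of v] by simp

text \<open>A greedy basis of minimum weight has at most the average weight of \<open>S\<close>. By
  \<open>dense\<close> the light elements of \<open>S\<close> span a proportionate share of the
  dimension, so the greedy choice takes enough of them.\<close>

lemma light_basis:
  fixes w :: "'i \<Rightarrow> nat"
  assumes "finite S" and dense: "\<And>T. T \<subseteq> S \<Longrightarrow> card T * fs.dim (v ` S) \<le> fs.dim (v ` T) * card S"
  obtains B where "B \<subseteq> S" "indep_on v B" "v ` S \<subseteq> fs.span (v ` B)"
    "card S * (\<Sum>b\<in>B. w b) \<le> fs.dim (v ` S) * (\<Sum>i\<in>S. w i)"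
proof -
  define L where "L t = {i\<in>S. w i \<le> t}" for t
  have fL: "finite (L t)" for t
    using assms(1) by (simp add: L_def)
  \<comment> \<open>Adding the weight layers in increasing order yields a single \<open>B\<close>
    that contains a spanning set of every layer \<open>L s\<close> at once.\<close>
  have "\<exists>B. B \<subseteq> L t \<and> indep_on v B \<and> (\<forall>s\<le>t. v ` L s \<subseteq> fs.span (v ` (B \<inter> L s)))" for t
  proof (induction t)
    case 0
    obtain B where B: "B \<subseteq> L 0" "indep_on v B" "v ` L 0 \<subseteq> fs.span (v ` B)"
      using indep_on_extend[OF fL[of 0], of v "{}"] fs.independent_empty
      by (metis empty_subsetI image_empty indep_on_def inj_on_empty)
    then show ?case by (intro exI[of _ B]) (auto simp: Int_absorb2)
  next
    case (Suc t)
    then obtain B where B: "B \<subseteq> L t" "indep_on v B" "\<forall>s\<le>t. v ` L s \<subseteq> fs.span (v ` (B \<inter> L s))"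
      by blast
    have "B \<subseteq> L (Suc t)" using B(1) by (auto simp: L_def)
    then obtain B' where B': "B \<subseteq> B'" "B' \<subseteq> L (Suc t)" "indep_on v B'" "v ` L (Suc t) \<subseteq> fs.span (v ` B')"
      using indep_on_extend[OF fL B(2)] by metis
    have "v ` L s \<subseteq> fs.span (v ` (B' \<inter> L s))" if "s \<le> Suc t" for s
    proof (cases "s = Suc t")
      case True
      then show ?thesis using B' by (simp add: Int_absorb2)
    next
      case False
      have "fs.span (v ` (B \<inter> L s)) \<subseteq> fs.span (v ` (B' \<inter> L s))"
        using B'(1) by (intro fs.span_mono) auto
      then show ?thesis
        using B(3) that False by (meson le_SucE order_trans)
    qed
    then show ?case using B' by blast
  qed
  \<comment> \<open>The total weight is a crude bound for every single weight, so \<open>L W\<close>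
    is all of \<open>S\<close>.\<close>
  moreover define W where "W = (\<Sum>i\<in>S. w i)"
  ultimately obtain B where B: "B \<subseteq> L W" "indep_on v B"
    "\<And>s. s \<le> W \<Longrightarrow> v ` L s \<subseteq> fs.span (v ` (B \<inter> L s))"
    by blast
  have wW: "w i \<le> W" if "i \<in> S" for i
    unfolding W_def using that assms(1) by (intro member_le_sum) auto
  then have LW: "L W = S" by (auto simp: L_def)
  \<comment> \<open>Layer-cake summation: \<open>w i\<close> is the number of thresholds
    \<open>t\<close> below it. The claim thus reduces to comparing \<open>B - L t\<close> with
    \<open>S - L t\<close> for each \<open>t\<close>.\<close>
  have layer: "(\<Sum>i\<in>A. w i) = (\<Sum>t<W. card (A - L t))" if "A \<subseteq> S" for A
  proof -
    have "w i = (\<Sum>t<W. if t < w i then 1 else 0)" if "i \<in> A" for i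
    proof -
      have "(\<Sum>t<W. if t < w i then 1 else 0) = card ({..<W} \<inter> {t. t < w i})"
        by (simp add: sum.If_cases)
      also have "{..<W} \<inter> {t. t < w i} = {..<w i}"
        using wW[of i] that \<open>A \<subseteq> S\<close> by auto
      finally show ?thesis by simp
    qed
    then have "(\<Sum>i\<in>A. w i) = (\<Sum>i\<in>A. \<Sum>t<W. if t < w i then 1 else 0)"
      by (rule sum.cong[OF refl])
    also have "\<dots> = (\<Sum>t<W. \<Sum>i\<in>A. if t < w i then 1 else 0)"
      by (rule sum.swap)
    also have "\<dots> = (\<Sum>t<W. card (A \<inter> {i. t < w i}))"
      using that assms(1) by (simp add: sum.If_cases finite_subset)
    also have "(\<lambda>t. A \<inter> {i. t < w i}) = (\<lambda>t. A - L t)"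
      using that by (auto simp: L_def fun_eq_iff)
    finally show ?thesis .
  qed
  have BS: "B \<subseteq> S" and fB: "finite B"
    using B(1) LW assms(1) finite_subset by auto
  \<comment> \<open>\<open>B\<close> has at most \<open>dim (v\<close>
    S)\<open>elements, and those in\<close>L t\<open>number at least\<close>dim (v
    \<open>L t)\<close>. Density bounds the latter from below, so few elements of \<open>B\<close>
    are left outside \<open>L t\<close>.\<close>
  have step: "card S * card (B - L t) \<le> fs.dim (v ` S) * card (S - L t)" if "t < W" for t
  proof -
    have LS: "L t \<subseteq> S" by (auto simp: L_def)
    have 1: "card B = card (B - L t) + card (B \<inter> L t)"
      using fB by (metis Int_commute add.commute card_Int_Diff)
    have 2: "card S = card (S - L t) + card (L t)"
      using assms(1) LS by (metis add.commute card_Diff_subset card_mono fL le_add_diff_inverse)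
    have "fs.dim (v ` L t) \<le> card (B \<inter> L t)"
      using fB that B(3)[of t] by (intro dim_le_card_spanning) auto
    then have "card (L t) * fs.dim (v ` S) \<le> card (B \<inter> L t) * card S"
      using dense[OF LS] mult_le_mono1 order_trans by blast
    moreover have "card B * card S \<le> fs.dim (v ` S) * card S"
      using indep_on_card_le_dim[OF assms(1) BS B(2)] by (rule mult_le_mono1)
    moreover have "card B * card S = card S * card (B - L t) + card (B \<inter> L t) * card S"
      by (subst 1) (simp add: algebra_simps)
    moreover have "fs.dim (v ` S) * card S = fs.dim (v ` S) * card (S - L t) + card (L t) * fs.dim (v ` S)"
      by (subst 2) (simp add: algebra_simps)
    ultimately show ?thesis by linarith
  qed
  have "card S * (\<Sum>b\<in>B. w b) \<le> fs.dim (v ` S) * (\<Sum>i\<in>S. w i)"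
    unfolding layer[OF BS] layer[OF order_refl] sum_distrib_left
    by (intro sum_mono step) auto
  moreover have "v ` S \<subseteq> fs.span (v ` B)"
    using B(3)[of W] LW BS by (simp add: Int_absorb2)
  ultimately show ?thesis
    using that BS B(2) by blast
qed

text \<open>The block matrix with \<open>g\<close> in the corner, last row \<open>x\<close>, last
  column \<open>y\<close> and 0 as the final entry. For invertible \<open>g\<close> its determinant
  is, by the Schur complement, minus \<open>det g\<close> times the value of the bilinear form of
  the inverse of \<open>g\<close> at \<open>x\<close> and \<open>y\<close>.\<close>

definition bordered :: "nat \<Rightarrow> (nat \<Rightarrow> nat \<Rightarrow> real) \<Rightarrow> (nat \<Rightarrow> real) \<Rightarrow> (nat \<Rightarrow> real) \<Rightarrow> real mat" where
  "bordered k g x y = mat (Suc k) (Suc k) (\<lambda>(r, c).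
     if r < k then if c < k then g r c else y r else if c < k then x c else 0)"

text \<open>A kernel vector of the bordered Gram matrix is a linear relation between the \<open>e r\<close> and \<open>q\<close>
  whose part on the \<open>e r\<close> is orthogonal to \<open>p\<close>.\<close>

lemma det_bordered_gram_eq_0_iff:
  assumes e: "e ` {..<k} \<subseteq> supported d" "indep_on e {..<k}" and q: "q \<in> fs.span (e ` {..<k})"
  shows "det (bordered k (\<lambda>r c. dot d (e r) (e c)) (\<lambda>c. dot d p (e c)) (\<lambda>r. dot d (e r) q)) = 0
    \<longleftrightarrow> dot d p q = 0"
proof -
  define A where "A = bordered k (\<lambda>r c. dot d (e r) (e c)) (\<lambda>c. dot d p (e c)) (\<lambda>r. dot d (e r) q)"
  have A: "A \<in> carrier_mat (Suc k) (Suc k)"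
    by (simp add: A_def bordered_def)
  define lc where "lc y = (\<Sum>c<k. fscale (vec_index y c) (e c))" for y
  have Ay: "vec_index (A *\<^sub>v y) r =
      (if r < k then dot d (e r) (lc y + fscale (vec_index y k) q) else dot d p (lc y))"
    if "y \<in> carrier_vec (Suc k)" "r < Suc k" for y r
  proof -
    have "vec_index (A *\<^sub>v y) r = (\<Sum>c<Suc k. index_mat A (r, c) * vec_index y c)"
      using that A by (auto simp: scalar_prod_def A_def bordered_def atLeast0LessThan intro!: sum.cong)
    also have "\<dots> = (if r < k then dot d (e r) (lc y + fscale (vec_index y k) q) else dot d p (lc y))"
      using that by (auto simp: A_def bordered_def lc_def dot_add_right dot_sum_right dot_fscale_right mult_ac)
    finally show ?thesis .
  qed
  have inj: "inj_on e {..<k}" and ind: "fs.independent (e ` {..<k})"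
    using e(2) by (auto simp: indep_on_def)
  have "det A = 0 \<longleftrightarrow> dot d p q = 0"
  proof
    assume "det A = 0"
    then obtain y where y: "y \<in> carrier_vec (Suc k)" "y \<noteq> 0\<^sub>v (Suc k)" "A *\<^sub>v y = 0\<^sub>v (Suc k)"
      using det_0_iff_vec_prod_zero_field[OF A] by blast
    \<comment> \<open>The first \<open>k\<close> rows say that \<open>z\<close> is orthogonal to
      every \<open>e r\<close>. It also lies in their span, so it is orthogonal to itself and
      vanishes by definiteness.\<close>
    define z where "z = lc y + fscale (vec_index y k) q"
    have zs: "z \<in> fs.span (e ` {..<k})"
      unfolding z_def lc_def by (intro fs.span_add fs.span_sum fs.span_scale q fs.span_base) auto
    have "dot d (e r) z = 0" if "r < k" for r
      using Ay[OF y(1), of r] y(3) that by (simp add: z_def)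
    then have "dot d z z = 0"
      using zs by (intro dot_span_eq_0[OF zs]) (auto simp: dot_commute[of d z])
    moreover have "z \<in> supported d"
      using zs e(1) fs.span_minimal[OF _ subspace_supported] by blast
    ultimately have z0: "z = 0"
      using supported_dot_self_eq_0 by blast
    have "dot d p (lc y) = 0"
      using Ay[OF y(1), of k] y(3) by simp
    moreover have "dot d p (lc y) + vec_index y k * dot d p q = dot d p z"
      by (simp add: z_def dot_add_right dot_fscale_right)
    ultimately have "vec_index y k * dot d p q = 0"
      using z0 by simp
    \<comment> \<open>Otherwise \<open>lc y = 0\<close> is a relation among the \<open>e c\<close>
      alone, and independence would make the kernel vector zero.\<close>
    moreover have "vec_index y k \<noteq> 0"
    proof
      assume yk: "vec_index y k = 0"
      then have "lc y = 0"
        using z0 by (simp add: z_def)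
      have "(\<Sum>b\<in>e ` {..<k}. fscale (vec_index y (inv_into {..<k} e b)) b) = lc y"
        unfolding lc_def by (subst sum.reindex[OF inj]) (auto simp: inv_into_f_f[OF inj] intro!: sum.cong)
      then have "\<forall>b\<in>e ` {..<k}. vec_index y (inv_into {..<k} e b) = 0"
        unfolding \<open>lc y = 0\<close> by (intro ballI fs.independentD[OF ind _ order_refl]) auto
      then have "vec_index y c = 0" if "c < Suc k" for c
        using that yk inv_into_f_f[OF inj] by (cases "c = k") auto
      then show False
        using y(1,2) by (metis carrier_vecD eq_vecI index_zero_vec)
    qed
    ultimately show "dot d p q = 0" by simp
  next
    assume pq: "dot d p q = 0"
    from q obtain a where "q = (\<Sum>b\<in>e ` {..<k}. fscale (a b) b)"
      by (auto simp: fs.span_finite)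
    then have qa: "q = (\<Sum>c<k. fscale (a (e c)) (e c))"
      by (simp add: sum.reindex[OF inj] o_def)
    \<comment> \<open>The kernel vector writes \<open>q\<close> in terms of the \<open>e c\<close>
      and subtracts \<open>q\<close> through the last coordinate.\<close>
    define y where "y = vec (Suc k) (\<lambda>c. if c < k then a (e c) else -1)"
    have y: "y \<in> carrier_vec (Suc k)"
      by (simp add: y_def)
    have lcy: "lc y = q"
      unfolding lc_def qa by (intro sum.cong) (auto simp: y_def)
    have "lc y + fscale (vec_index y k) q = 0"
      unfolding lcy by (simp add: fun_eq_iff fscale_apply y_def)
    then have "A *\<^sub>v y = 0\<^sub>v (Suc k)"
      using Ay[OF y] A pq lcy by (intro eq_vecI) auto
    moreover have "y \<noteq> 0\<^sub>v (Suc k)"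
    proof
      assume "y = 0\<^sub>v (Suc k)"
      then have "vec_index y k = 0" by simp
      then show False by (simp add: y_def)
    qed
    ultimately show "det A = 0"
      using det_0_iff_vec_prod_zero_field[OF A] y by blast
  qed
  then show ?thesis by (simp add: A_def)
qed

text \<open>Minimising \<open>dim (x ` S) / card S\<close> makes every subfamily of \<open>S\<close> at least as spread out as \<open>S\<close>
  itself, which is what \<open>light_basis\<close> needs; it also forces every vertex of \<open>S\<close> to have large degree.\<close>

lemma sparse_gram:
  assumes "0 < n" and sup: "\<And>i. i < n \<Longrightarrow> x i \<in> supported d" and nz: "\<And>i. i < n \<Longrightarrow> x i \<noteq> 0"
  obtains S B where "S \<subseteq> {..<n}" "S \<noteq> {}" "B \<subseteq> S" "indep_on x B" "x ` S \<subseteq> fs.span (x ` B)"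
    "n * card S \<le> d * card {(i, j). i \<in> S \<and> j \<in> S \<and> dot d (x i) (x j) \<noteq> 0}"
    "n * card {(i, b). i \<in> S \<and> b \<in> B \<and> dot d (x i) (x b) \<noteq> 0}
      \<le> d * card {(i, j). i \<in> S \<and> j \<in> S \<and> dot d (x i) (x j) \<noteq> 0}"
proof -
  define \<rho> where "\<rho> S = real (fs.dim (x ` S)) / real (card S)" for S
  define \<S> where "\<S> = {S. S \<subseteq> {..<n} \<and> S \<noteq> {}}"
  have \<S>: "finite \<S>" "{..<n} \<in> \<S>"
    using \<open>0 < n\<close> by (auto simp: \<S>_def)
  define S where "S = arg_min_on \<rho> \<S>"
  have "S \<in> \<S>" and min: "\<And>T. T \<in> \<S> \<Longrightarrow> \<rho> S \<le> \<rho> T"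
    using arg_min_if_finite[of \<S> \<rho>] \<S> unfolding S_def by (auto simp: not_less)
  then have S: "S \<subseteq> {..<n}" "S \<noteq> {}" and fS: "finite S"
    by (auto simp: \<S>_def finite_subset)
  define r where "r = fs.dim (x ` S)"
  define m where "m = card S"
  have m: "0 < m"
    using S fS by (simp add: m_def card_gt_0_iff)
  have dense: "card T * r \<le> fs.dim (x ` T) * m" if "T \<subseteq> {..<n}" for T
  proof (cases "T = {}")
    case False
    then have "0 < card T"
      using that by (simp add: card_gt_0_iff finite_subset)
    have "\<rho> S \<le> \<rho> T"
      using that False by (intro min) (simp add: \<S>_def)
    then have "real (card T * r) \<le> real (fs.dim (x ` T) * m)"
      using m \<open>0 < card T\<close> by (simp add: \<rho>_def r_def m_def field_simps)
    then show ?thesis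
      by (simp only: of_nat_le_iff)
  qed simp
  have "fs.dim (x ` {..<n}) \<le> d"
  proof -
    obtain C where "C \<subseteq> x ` {..<n}" "fs.independent C" "card C = fs.dim (x ` {..<n})"
      using fs.basis_exists by metis
    then show ?thesis
      using independent_card_le_supported[of C d] sup by force
  qed
  \<comment> \<open>Compare the minimiser \<open>S\<close> with the full vertex set, whose span has
    dimension at most \<open>d\<close>.\<close>
  then have nr: "n * r \<le> d * m"
    using dense[of "{..<n}"] mult_le_mono1 order_trans by fastforce
  define g where "g i j = dot d (x i) (x j)" for i j
  have g_comm: "g i j = g j i" for i j
    by (simp add: g_def dot_commute)
  have g_self: "g i i \<noteq> 0" if "i \<in> S" for i
    using S(1) that sup[of i] nz[of i] by (auto simp: g_def supported_dot_self_eq_0)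
  define deg where "deg i = card {j\<in>S. g i j \<noteq> 0}" for i
  \<comment> \<open>The vectors indexed by the non-neighbours \<open>T\<close> of \<open>i\<close>
    are orthogonal to \<open>x i\<close>, which is nonzero. Hence their span misses
    \<open>x i\<close> and has dimension at most \<open>r - 1\<close>. Density of \<open>T\<close>
    turns this into an upper bound on \<open>card T\<close>; here \<open>i\<close> counts as its own
    neighbour.\<close>
  have deg: "m \<le> r * deg i" if i: "i \<in> S" for i
  proof -
    define T where "T = {j\<in>S. g i j = 0}"
    have TS: "T \<subseteq> S" "finite T"
      using fS by (auto simp: T_def)
    obtain C where C: "C \<subseteq> T" "indep_on x C" "x ` T \<subseteq> fs.span (x ` C)"
      using indep_on_extend[OF TS(2), of x "{}"] fs.independent_empty
      by (metis empty_subsetI image_empty indep_on_def inj_on_empty)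
    have "x i \<notin> fs.span (x ` C)"
    proof
      assume "x i \<in> fs.span (x ` C)"
      then have "dot d (x i) (x i) = 0"
        using C(1) by (rule_tac dot_span_eq_0) (auto simp: T_def g_def)
      then show False
        using g_self[OF i] by (simp add: g_def)
    qed
    then have "indep_on x (insert i C)"
      using C(2) by (rule_tac indep_on_insert)
    then have "card (insert i C) \<le> r"
      unfolding r_def using C(1) TS(1) i by (intro indep_on_card_le_dim fS) auto
    moreover have "i \<notin> C"
      using C(1) g_self[OF i] by (auto simp: T_def)
    moreover have "finite C"
      using C(1) TS(2) finite_subset by blast
    ultimately have "Suc (card C) \<le> r"
      by simp
    moreover have "fs.dim (x ` T) \<le> card C"
      using \<open>finite C\<close> C(3) by (rule dim_le_card_spanning)
    ultimately have "Suc (fs.dim (x ` T)) * m \<le> r * m"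
      by (intro mult_le_mono1) simp
    moreover have "card T * r \<le> fs.dim (x ` T) * m"
      using TS(1) S(1) by (intro dense) auto
    moreover have "m = card T + deg i"
    proof -
      have "S = T \<union> {j\<in>S. g i j \<noteq> 0}"
        by (auto simp: T_def)
      then have "card S = card (T \<union> {j\<in>S. g i j \<noteq> 0})"
        by simp
      also have "\<dots> = card T + deg i"
        unfolding deg_def using fS by (intro card_Un_disjoint) (auto simp: T_def)
      finally show ?thesis by (simp add: m_def)
    qed
    then have "r * m = card T * r + r * deg i"
      by (simp add: algebra_simps)
    ultimately show ?thesis
      by simp
  qed
  define s where "s = card {(i, j). i \<in> S \<and> j \<in> S \<and> g i j \<noteq> 0}"
  have sum_deg: "(\<Sum>b\<in>A. deg b) = card {(i, b). i \<in> S \<and> b \<in> A \<and> g i b \<noteq> 0}" if "A \<subseteq> S" for A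
  proof -
    have "finite A"
      using that fS finite_subset by blast
    then have "(\<Sum>b\<in>A. deg b) = card (SIGMA b:A. {j\<in>S. g b j \<noteq> 0})"
      unfolding deg_def using fS by simp
    also have "\<dots> = card (prod.swap ` (SIGMA b:A. {j\<in>S. g b j \<noteq> 0}))"
      by (simp add: card_image)
    also have "prod.swap ` (SIGMA b:A. {j\<in>S. g b j \<noteq> 0}) = {(i, b). i \<in> S \<and> b \<in> A \<and> g i b \<noteq> 0}"
      using g_comm by (force simp: image_iff)
    finally show ?thesis .
  qed
  have "m * m = (\<Sum>i\<in>S. m)"
    by (simp add: m_def)
  also have "\<dots> \<le> (\<Sum>i\<in>S. r * deg i)"
    by (intro sum_mono deg)
  also have "\<dots> = r * s"
    by (simp add: sum_distrib_left[symmetric] sum_deg s_def)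
  finally have mm: "m * m \<le> r * s" .
  \<comment> \<open>Since \<open>r / m\<close> is at most \<open>d / n\<close>, bounds relative to
    \<open>S\<close> become bounds in \<open>d\<close> and \<open>n\<close>.\<close>
  have scale: "n * a \<le> d * s" if "m * a \<le> r * s" for a
  proof -
    have "m * (n * a) = n * (m * a)"
      by simp
    also have "\<dots> \<le> n * (r * s)"
      using that by (rule mult_le_mono2)
    also have "\<dots> = (n * r) * s"
      by simp
    also have "\<dots> \<le> (d * m) * s"
      using nr by (rule mult_le_mono1)
    also have "\<dots> = m * (d * s)"
      by simp
    finally show ?thesis
      using m by simp
  qed
  \<comment> \<open>The weights for the light basis are the degrees, so a light basis is one whose
    columns have few nonzero entries.\<close>
  have "card T * fs.dim (x ` S) \<le> fs.dim (x ` T) * card S" if "T \<subseteq> S" for T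
    using dense[of T] S(1) that by (simp add: m_def r_def)
  then obtain B where B: "B \<subseteq> S" "indep_on x B" "x ` S \<subseteq> fs.span (x ` B)"
    "m * (\<Sum>b\<in>B. deg b) \<le> r * (\<Sum>i\<in>S. deg i)"
    unfolding m_def r_def by (rule light_basis[OF fS, where w = deg])
  show ?thesis
  proof
    show "n * card S \<le> d * card {(i, j). i \<in> S \<and> j \<in> S \<and> dot d (x i) (x j) \<noteq> 0}"
      using scale[OF mm] by (simp add: s_def g_def m_def)
    have "m * card {(i, b). i \<in> S \<and> b \<in> B \<and> g i b \<noteq> 0} \<le> r * s"
      using B(4) sum_deg[OF B(1)] sum_deg[of S] by (simp add: s_def)
    from scale[OF this] show "n * card {(i, b). i \<in> S \<and> b \<in> B \<and> dot d (x i) (x b) \<noteq> 0}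
      \<le> d * card {(i, j). i \<in> S \<and> j \<in> S \<and> dot d (x i) (x j) \<noteq> 0}"
      by (simp add: s_def g_def)
  qed (use S B in auto)
qed

text \<open>Variables are indexed by the positions in \<open>P\<close> of the nonzero entries of the columns of a Gram
  matrix that belong to a basis; rows are \<open>fst ` P\<close> and the basis columns are \<open>snd ` P\<close>.\<close>

definition entry :: "(nat \<times> nat) set \<Rightarrow> (nat \<times> nat \<Rightarrow> real) \<Rightarrow> nat \<Rightarrow> nat \<Rightarrow> real" where
  "entry P u a b = (if (a, b) \<in> P then u (a, b) else 0)"

text \<open>Basis indices serve as rows and as columns, so the corner block is read off from
  \<open>P\<close> too. Symmetry of the Gram matrix lets the border column use the row of
  \<open>j\<close>. All entries are variables or 0, and the Gram entry itself is recovered only up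
  to a nonzero factor, which suffices for its zero pattern.\<close>

definition pdet :: "(nat \<times> nat) set \<Rightarrow> (nat \<times> nat \<Rightarrow> real) \<Rightarrow> nat \<Rightarrow> nat \<Rightarrow> real" where
  "pdet P u i j = (let bs = sorted_list_of_set (snd ` P) in
     det (bordered (length bs) (\<lambda>r c. entry P u (bs ! r) (bs ! c))
       (\<lambda>c. entry P u i (bs ! c)) (\<lambda>r. entry P u j (bs ! r))))"

definition row_pairs :: "(nat \<times> nat) set \<Rightarrow> (nat \<times> nat) set" where
  "row_pairs P = {(i, j). i \<in> fst ` P \<and> j \<in> fst ` P \<and> i < j}"

definition pattern :: "(nat \<times> nat) set \<Rightarrow> (nat \<times> nat \<Rightarrow> real) \<Rightarrow> (nat \<times> nat) set" where
  "pattern P u = {ij \<in> row_pairs P. pdet P u (fst ij) (snd ij) \<noteq> 0}"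

lemma poly_fun_entry:
  assumes "finite P"
  shows "poly_fun P 1 (\<lambda>u. entry P u a b)"
proof (cases "(a, b) \<in> P")
  case True
  then show ?thesis
    using poly_fun_var[OF assms True] by (simp add: entry_def)
next
  case False
  then show ?thesis
    using poly_fun_const[of 0 P 1] by (simp add: entry_def)
qed

lemma poly_fun_pdet:
  assumes "finite P"
  shows "poly_fun P (Suc (card (snd ` P))) (\<lambda>u. pdet P u i j)"
proof -
  define bs where "bs = sorted_list_of_set (snd ` P)"
  define A where "A u r c = (if r < length bs then if c < length bs then entry P u (bs ! r) (bs ! c)
      else entry P u j (bs ! r) else if c < length bs then entry P u i (bs ! c) else 0)" for u r c
  have "poly_fun P 1 (\<lambda>u. A u r c)" for r c
    unfolding A_def using poly_fun_entry[OF assms] poly_fun_const[of 0 P 1]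
    by (cases "r < length bs"; cases "c < length bs") simp_all
  then have "poly_fun P (Suc (length bs)) (\<lambda>u. det (mat (Suc (length bs)) (Suc (length bs)) (\<lambda>(r, c). A u r c)))"
    by (intro poly_fun_det)
  moreover have len: "length bs = card (snd ` P)"
    by (simp add: bs_def)
  ultimately show ?thesis
    unfolding pdet_def Let_def bordered_def A_def bs_def[symmetric] len[symmetric] by simp
qed

lemma card_patterns_le:
  assumes "P \<subseteq> {..<n} \<times> {..<n}" "2 \<le> n"
  shows "card (range (pattern P)) \<le> (n ^ 4) ^ card P"
proof -
  have fP: "finite P"
    using assms(1) by (rule finite_subset) auto
  have fJ: "finite (row_pairs P)"
    by (rule finite_subset[of _ "fst ` P \<times> fst ` P"]) (auto simp: row_pairs_def fP)
  have "card (range (pattern P)) \<le> (card (row_pairs P) * Suc (card (snd ` P)) + 1) ^ card P"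
    unfolding pattern_def using fP fJ poly_fun_pdet[OF fP]
    by (intro card_zero_patterns_le) auto
  also have "\<dots> \<le> (n ^ 4) ^ card P"
  proof (rule power_mono)
    have "card (row_pairs P) \<le> card ({..<n} \<times> {..<n})"
      using assms(1) by (intro card_mono) (auto simp: row_pairs_def)
    moreover have "card (snd ` P) \<le> card {..<n}"
      using assms(1) by (intro card_mono) auto
    ultimately have "card (row_pairs P) * Suc (card (snd ` P)) + 1 \<le> (n * n) * Suc n + 1"
      by (intro add_mono mult_mono) auto
    \<comment> \<open>After substituting \<open>n = k + 2\<close>, the difference of the two sides
      has only nonnegative coefficients.\<close>
    also have "\<dots> \<le> n ^ 4"
    proof -
      obtain k where "n = k + 2"
        using assms(2) by (metis add.commute le_Suc_ex)
      then show ?thesis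
        by (simp add: power4_eq_xxxx algebra_simps)
    qed
    finally show "card (row_pairs P) * Suc (card (snd ` P)) + 1 \<le> n ^ 4" .
  qed simp
  finally show ?thesis .
qed

text \<open>\<open>P\<close> alone determines \<open>S\<close> and \<open>B\<close>: a nonzero
  vector in the span of the basis is not orthogonal to all basis vectors, and diagonal entries are
  nonzero. The bordered determinants then detect all remaining entries.\<close>

lemma gram_pattern:
  assumes "finite S" "B \<subseteq> S" and sup: "x ` S \<subseteq> supported d" and nz: "0 \<notin> x ` S"
    and ind: "indep_on x B" and span: "x ` S \<subseteq> fs.span (x ` B)"
    and P: "P = {(i, b). i \<in> S \<and> b \<in> B \<and> dot d (x i) (x b) \<noteq> 0}"
  shows "pattern P (\<lambda>(i, b). dot d (x i) (x b)) = {(i, j). i \<in> S \<and> j \<in> S \<and> i < j \<and> dot d (x i) (x j) \<noteq> 0}"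
proof -
  have self: "dot d (x i) (x i) \<noteq> 0" if "i \<in> S" for i
  proof -
    have "x i \<in> supported d" "x i \<noteq> 0"
      using that sup nz by (blast, metis image_eqI)
    then show ?thesis
      by (simp add: supported_dot_self_eq_0)
  qed
  have mem_P: "(i, b) \<in> P \<longleftrightarrow> i \<in> S \<and> b \<in> B \<and> dot d (x i) (x b) \<noteq> 0" for i b
    unfolding P by simp
  have "i \<in> fst ` P" if i: "i \<in> S" for i
  proof (rule ccontr)
    assume "i \<notin> fst ` P"
    then have "(i, b) \<notin> P" for b
      by (metis fst_conv image_eqI)
    then have "dot d (x i) a = 0" if "a \<in> x ` B" for a
      using that i mem_P by blast
    moreover have "x i \<in> fs.span (x ` B)"
      using span imageI[OF i] by (rule subsetD)
    ultimately have "dot d (x i) (x i) = 0"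
      by (rule_tac dot_span_eq_0)
    then show False
      using self[OF i] by simp
  qed
  moreover have "fst ` P \<subseteq> S" "snd ` P \<subseteq> B"
    using mem_P by (auto simp del: split_paired_All)
  moreover have "b \<in> snd ` P" if "b \<in> B" for b
  proof -
    have "(b, b) \<in> P"
      using that self assms(2) mem_P by blast
    then show ?thesis
      by (metis snd_conv image_eqI)
  qed
  ultimately have S: "fst ` P = S" and B: "snd ` P = B"
    by (simp_all add: subset_antisym subsetI)
  define u where "u = (\<lambda>(i, b). dot d (x i) (x b))"
  define bs where "bs = sorted_list_of_set B"
  have fB: "finite B"
    using assms(1,2) finite_subset by blast
  have bs: "set bs = B" "distinct bs"
    using fB by (auto simp: bs_def)
  have ent: "entry P u a (bs ! c) = dot d (x a) (x (bs ! c))" if "a \<in> S" "c < length bs" for a c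
    using that bs(1) nth_mem[of c bs] mem_P[of a "bs ! c"] by (simp add: entry_def u_def)
  define e where "e r = x (bs ! r)" for r
  have img: "e ` {..<length bs} = x ` B"
    using bs(1) by (auto simp: e_def set_conv_nth)
  have inj: "inj_on e {..<length bs}"
    using ind bs unfolding e_def indep_on_def inj_on_def
    by (metis lessThan_iff nth_eq_iff_index_eq nth_mem)
  have e: "indep_on e {..<length bs}"
    using ind inj by (simp add: indep_on_def img)
  have pd: "pdet P u i j \<noteq> 0 \<longleftrightarrow> dot d (x i) (x j) \<noteq> 0" if ij: "i \<in> S" "j \<in> S" for i j
  proof -
    have "bordered (length bs) (\<lambda>r c. entry P u (bs ! r) (bs ! c))
        (\<lambda>c. entry P u i (bs ! c)) (\<lambda>r. entry P u j (bs ! r)) =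
      bordered (length bs) (\<lambda>r c. dot d (e r) (e c)) (\<lambda>c. dot d (x i) (e c)) (\<lambda>r. dot d (e r) (x j))"
      unfolding bordered_def
    proof (rule cong_mat)
      fix r c assume "r < Suc (length bs)" "c < Suc (length bs)"
      moreover have "bs ! r \<in> S" if "r < length bs"
        using that bs(1) assms(2) nth_mem by blast
      ultimately show "(case (r, c) of (r, c) \<Rightarrow> if r < length bs then if c < length bs then entry P u (bs ! r) (bs ! c)
           else entry P u j (bs ! r) else if c < length bs then entry P u i (bs ! c) else 0) =
        (case (r, c) of (r, c) \<Rightarrow> if r < length bs then if c < length bs then dot d (e r) (e c)
           else dot d (e r) (x j) else if c < length bs then dot d (x i) (e c) else 0)"
        using ent ij by (auto simp: e_def dot_commute)
    qed auto
    then have "pdet P u i j = det (bordered (length bs) (\<lambda>r c. dot d (e r) (e c))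
        (\<lambda>c. dot d (x i) (e c)) (\<lambda>r. dot d (e r) (x j)))"
      by (simp add: pdet_def B bs_def)
    moreover have "e ` {..<length bs} \<subseteq> supported d"
      unfolding img using sup assms(2) by blast
    moreover have "x j \<in> fs.span (e ` {..<length bs})"
      unfolding img using span ij(2) by blast
    ultimately show ?thesis
      using det_bordered_gram_eq_0_iff[OF _ e, of d "x j" "x i"] by simp
  qed
  then have "pattern P u = {(i, j). i \<in> S \<and> j \<in> S \<and> i < j \<and> dot d (x i) (x j) \<noteq> 0}"
    by (auto simp: pattern_def row_pairs_def S)
  then show ?thesis
    by (simp add: u_def)
qed

text \<open>Turns a representation into data for a union bound: edges \<open>H\<close> that must all
  be present, encoded by the few positions \<open>P\<close>. The bound on \<open>n\<close> ensures
  that \<open>H\<close> is large.\<close>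

lemma orth_rep_pattern:
  assumes "0 < n" "2 * d \<le> n" "orth_rep n E d v"
  obtains P H where "P \<subseteq> {..<n} \<times> {..<n}" "H \<in> range (pattern P)"
    "n * card P \<le> 4 * d * card H" "n \<le> 4 * d * card H"
    "H \<subseteq> {(i, j). i < j \<and> j < n \<and> {i, j} \<in> E}"
proof -
  \<comment> \<open>Coordinates from \<open>d\<close> on are irrelevant to \<open>orth_rep\<close>;
    zeroing them places the vectors in \<open>supported d\<close>.\<close>
  define x where "x i = (\<lambda>k. if k < d then v i k else 0)" for i
  have sup: "x i \<in> supported d" for i
    by (simp add: x_def supported_def)
  have nz: "x i \<noteq> 0" if i: "i < n" for i
  proof -
    obtain k where "k < d" "v i k \<noteq> 0"
      using assms(3) i unfolding orth_rep_def by blast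
    then have "x i k \<noteq> 0"
      by (simp add: x_def)
    then show ?thesis
      by (metis zero_fun_apply)
  qed
  have dot: "dot d (x i) (x j) = (\<Sum>k<d. v i k * v j k)" for i j
    by (simp add: dot_def x_def)
  obtain S B where S: "S \<subseteq> {..<n}" "S \<noteq> {}" "B \<subseteq> S" "indep_on x B" "x ` S \<subseteq> fs.span (x ` B)"
    "n * card S \<le> d * card {(i, j). i \<in> S \<and> j \<in> S \<and> dot d (x i) (x j) \<noteq> 0}"
    "n * card {(i, b). i \<in> S \<and> b \<in> B \<and> dot d (x i) (x b) \<noteq> 0}
      \<le> d * card {(i, j). i \<in> S \<and> j \<in> S \<and> dot d (x i) (x j) \<noteq> 0}"
    by (rule sparse_gram[OF assms(1) sup nz])
  define P where "P = {(i, b). i \<in> S \<and> b \<in> B \<and> dot d (x i) (x b) \<noteq> 0}"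
  define H where "H = {(i, j). i \<in> S \<and> j \<in> S \<and> i < j \<and> dot d (x i) (x j) \<noteq> 0}"
  define Q where "Q = {(i, j). i \<in> S \<and> j \<in> S \<and> dot d (x i) (x j) \<noteq> 0}"
  have fS: "finite S"
    using S(1) finite_subset by blast
  have "finite H"
    by (rule finite_subset[of _ "S \<times> S"]) (auto simp: H_def fS)
  \<comment> \<open>The nonzero entries are those above the diagonal, their mirror images and the
    diagonal.\<close>
  have "Q \<subseteq> H \<union> prod.swap ` H \<union> (\<lambda>i. (i, i)) ` S"
    by (force simp: Q_def H_def image_iff dot_commute)
  then have "card Q \<le> card (H \<union> prod.swap ` H \<union> (\<lambda>i. (i, i)) ` S)"
    using \<open>finite H\<close> fS by (intro card_mono) auto
  also have "\<dots> \<le> card H + card (prod.swap ` H) + card ((\<lambda>i. (i, i)) ` S)"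
    by (meson add_mono card_Un_le order_refl order_trans)
  also have "\<dots> \<le> card H + card H + card S"
    using \<open>finite H\<close> fS by (intro add_mono card_image_le) auto
  finally have Q: "card Q \<le> 2 * card H + card S"
    by simp
  have nS: "n * card S \<le> d * card Q" and nP: "n * card P \<le> d * card Q"
    using S(6,7) by (simp_all add: P_def Q_def)
  \<comment> \<open>From \<open>2 * d \<le> n\<close>, the diagonal makes up at most half of
    \<open>Q\<close>. Hence the part above the diagonal is at least a quarter.\<close>
  have "2 * (n * card S) \<le> (2 * d) * card Q"
    using nS by simp
  also have "\<dots> \<le> n * card Q"
    using assms(2) by (rule mult_le_mono1)
  finally have "n * (2 * card S) \<le> n * card Q"
    by simp
  then have "2 * card S \<le> card Q"
    using assms(1) by (metis mult_le_cancel1)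
  with Q have Q4: "card Q \<le> 4 * card H"
    by simp
  then have dQ: "d * card Q \<le> 4 * d * card H"
    by (metis mult.assoc mult.commute mult_le_mono2)
  have "1 \<le> card S"
    using S(2) fS by (simp add: Suc_le_eq card_gt_0_iff)
  then have "n \<le> n * card S"
    by simp
  show ?thesis
  proof
    show "P \<subseteq> {..<n} \<times> {..<n}"
      using S(1,3) by (auto simp: P_def)
    have "0 \<notin> x ` S"
      using nz S(1) by force
    then have "pattern P (\<lambda>(i, b). dot d (x i) (x b)) = H"
      unfolding H_def using S sup by (intro gram_pattern[OF fS S(3)]) (auto simp: P_def)
    then show "H \<in> range (pattern P)"
      by blast
    show "n * card P \<le> 4 * d * card H"
      using nP dQ by linarith
    show "n \<le> 4 * d * card H"
      using \<open>n \<le> n * card S\<close> nS dQ by linarith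
    have "i < j \<and> j < n \<and> {i, j} \<in> E" if "(i, j) \<in> H" for i j
    proof -
      have "i \<in> S" "j \<in> S" "i < j" "dot d (x i) (x j) \<noteq> 0"
        using that by (auto simp: H_def)
      then show ?thesis
        using assms(3) S(1) dot[of i j] unfolding orth_rep_def by (metis lessThan_iff nat_neq_iff subsetD)
    qed
    then show "H \<subseteq> {(i, j). i < j \<and> j < n \<and> {i, j} \<in> E}"
      by auto
  qed
qed

section \<open>The lower bound\<close>

text \<open>Each induction step adds one element of \<open>X\<close> or nothing, which is at most
  \<open>card X + 1\<close> choices; adding nothing accounts for the empty set.\<close>

lemma card_small_subsets_le:
  fixes X :: "'a set"
  assumes "finite X"
  shows "finite {Q. Q \<subseteq> X \<and> card Q \<le> N}" "card {Q. Q \<subseteq> X \<and> card Q \<le> N} \<le> (card X + 1) ^ N"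
proof -
  define F where "F N = {Q. Q \<subseteq> X \<and> card Q \<le> N}" for N
  have fin: "finite (F N)" for N
    by (rule finite_subset[of _ "Pow X"]) (auto simp: F_def assms)
  then show "finite {Q. Q \<subseteq> X \<and> card Q \<le> N}"
    by (simp add: F_def)
  have "card (F N) \<le> (card X + 1) ^ N"
  proof (induction N)
    case 0
    have "F 0 = {{}}"
      using assms by (auto simp: F_def finite_subset)
    then show ?case by simp
  next
    case (Suc N)
    define h :: "'a set \<times> 'a option \<Rightarrow> 'a set"
      where "h = (\<lambda>(Q, x). case x of None \<Rightarrow> Q | Some y \<Rightarrow> insert y Q)"
    have "F (Suc N) \<subseteq> h ` (F N \<times> insert None (Some ` X))"
    proof
      fix Q assume Q: "Q \<in> F (Suc N)"
      show "Q \<in> h ` (F N \<times> insert None (Some ` X))"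
      proof (cases "Q = {}")
        case True
        then show ?thesis
          by (intro image_eqI[of _ _ "({}, None)"]) (auto simp: h_def F_def)
      next
        case False
        then obtain y where "y \<in> Q" by blast
        then show ?thesis
          using Q assms by (intro image_eqI[of _ _ "(Q - {y}, Some y)"])
            (auto simp: h_def F_def finite_subset card_Diff_singleton)
      qed
    qed
    then have "card (F (Suc N)) \<le> card (h ` (F N \<times> insert None (Some ` X)))"
      using fin assms by (intro card_mono) auto
    also have "\<dots> \<le> card (F N \<times> insert None (Some ` X))"
      using fin assms by (intro card_image_le) auto
    also have "\<dots> = card (F N) * (card X + 1)"
      using assms by (simp add: card_cartesian_product card_image card_insert_if image_iff)
    also have "\<dots> \<le> (card X + 1) ^ N * (card X + 1)"
      using Suc by (rule mult_le_mono1)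
    finally show ?case by (simp add: mult.commute)
  qed
  then show "card {Q. Q \<subseteq> X \<and> card Q \<le> N} \<le> (card X + 1) ^ N"
    by (simp add: F_def)
qed

text \<open>Distinct unit vectors represent every graph, so the \<open>LEAST\<close> in
  \<open>orth_dim\<close> is attained.\<close>

lemma orth_rep_trivial: "orth_rep n E n (\<lambda>i k. if k = i then 1 else 0)"
  by (auto simp: orth_rep_def intro!: sum.neutral)

lemma orth_rep_orth_dim: "\<exists>v. orth_rep n E (orth_dim n E) v"
  unfolding orth_dim_def by (rule LeastI[of "\<lambda>d. \<exists>v. orth_rep n E d v" n]) (use orth_rep_trivial in blast)

section \<open>Independent edge indicators and the union bound over patterns\<close>

definition edge_pmf :: "nat \<Rightarrow> real \<Rightarrow> (nat \<times> nat \<Rightarrow> bool) pmf" where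
  "edge_pmf n p = Pi_pmf {(i, j). i < j \<and> j < n} False (\<lambda>_. bernoulli_pmf p)"

definition graph_of :: "nat \<Rightarrow> (nat \<times> nat \<Rightarrow> bool) \<Rightarrow> nat set set" where
  "graph_of n f = {{i, j} | i j. i < j \<and> j < n \<and> f (i, j)}"

lemma finite_pairs: "finite {(i, j). i < j \<and> j < (n::nat)}"
  by (rule finite_subset[of _ "{..<n} \<times> {..<n}"]) auto

lemma prob_gnp: "measure_pmf.prob (gnp n p) A = measure_pmf.prob (edge_pmf n p) {f. graph_of n f \<in> A}"
  by (simp add: gnp_def edge_pmf_def graph_of_def vimage_def)

lemma graph_of_iff: "i < j \<Longrightarrow> {i, j} \<in> graph_of n f \<longleftrightarrow> j < n \<and> f (i, j)"
  by (auto simp: graph_of_def doubleton_eq_iff)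

lemma prob_all_edges:
  assumes "finite A" "H \<subseteq> A" "0 \<le> p" "p \<le> 1"
  shows "measure_pmf.prob (Pi_pmf A False (\<lambda>_. bernoulli_pmf p)) {f. \<forall>h\<in>H. f h} = p ^ card H"
proof -
  define B where "B h = (if h \<in> H then {True} else UNIV)" for h
  have "{f. \<forall>h\<in>H. f h} = Pi A B"
    using assms(2) by (auto simp: B_def Pi_def)
  then have "measure_pmf.prob (Pi_pmf A False (\<lambda>_. bernoulli_pmf p)) {f. \<forall>h\<in>H. f h} =
      (\<Prod>h\<in>A. measure_pmf.prob (bernoulli_pmf p) (B h))"
    using assms(1) by (simp add: measure_Pi_pmf_Pi)
  also have "\<dots> = (\<Prod>h\<in>A. if h \<in> H then p else 1)"
    using assms by (intro prod.cong) (auto simp: B_def measure_pmf_single)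
  also have "\<dots> = p ^ card (A \<inter> H)"
    using assms(1) by (simp add: prod.If_cases)
  finally show ?thesis
    using assms(2) by (simp add: Int_absorb1)
qed

text \<open>The candidates of the union bound, sorted by edge count \<open>e\<close>. The parameter
  \<kappa> is the number of encoding variables allowed per edge.\<close>

definition sparse_patterns :: "nat \<Rightarrow> real \<Rightarrow> nat \<Rightarrow> (nat \<times> nat) set set" where
  "sparse_patterns n \<kappa> e = {H. card H = e \<and> H \<subseteq> {(i, j). i < j \<and> j < n} \<and>
     (\<exists>P. P \<subseteq> {..<n} \<times> {..<n} \<and> real (card P) \<le> \<kappa> * real e \<and> H \<in> range (pattern P))}"

text \<open>With \<open>N\<close> the integer part of \<kappa> times \<open>e\<close>, there are at
  most \<open>n ^ (3 * N)\<close> choices of \<open>P\<close> and at most \<open>n ^ (4 * N)\<close>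
  patterns for each; this is the 7.\<close>

lemma card_sparse_patterns_le:
  assumes "2 \<le> n" "0 \<le> \<kappa>"
  shows "finite (sparse_patterns n \<kappa> e)"
    "real (card (sparse_patterns n \<kappa> e)) \<le> exp (7 * \<kappa> * real e * ln (real n))"
proof -
  define N where "N = nat \<lfloor>\<kappa> * real e\<rfloor>"
  define \<P> where "\<P> = {P. P \<subseteq> {..<n} \<times> {..<n} \<and> card P \<le> N}"
  define \<Q> where "\<Q> P = {H \<in> range (pattern P). H \<subseteq> {(i, j). i < j \<and> j < n}}" for P
  have fin: "finite \<P>" and cardP: "card \<P> \<le> (card ({..<n} \<times> {..<n}) + 1) ^ N"
    unfolding \<P>_def by (intro card_small_subsets_le; simp)+
  have finQ: "finite (\<Q> P)" for P
    by (rule finite_subset[of _ "Pow {(i, j). i < j \<and> j < n}"]) (auto simp: \<Q>_def finite_pairs)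
  have cardQ: "card (\<Q> P) \<le> (n ^ 4) ^ N" if "P \<in> \<P>" for P
  proof -
    have P: "P \<subseteq> {..<n} \<times> {..<n}" "card P \<le> N"
      using that by (auto simp: \<P>_def)
    have "finite P"
      using P(1) by (rule finite_subset) auto
    then have "range (pattern P) \<subseteq> Pow (fst ` P \<times> fst ` P)"
      by (auto simp: pattern_def row_pairs_def)
    then have "finite (range (pattern P))"
      by (rule finite_subset) (use \<open>finite P\<close> in auto)
    then have "card (\<Q> P) \<le> card (range (pattern P))"
      by (intro card_mono) (auto simp: \<Q>_def)
    also have "\<dots> \<le> (n ^ 4) ^ card P"
      using P(1) assms(1) by (rule card_patterns_le)
    also have "\<dots> \<le> (n ^ 4) ^ N"
      using assms(1) P(2) by (intro power_increasing) auto
    finally show ?thesis .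
  qed
  have sub: "sparse_patterns n \<kappa> e \<subseteq> (\<Union>P\<in>\<P>. \<Q> P)"
  proof
    fix H assume "H \<in> sparse_patterns n \<kappa> e"
    then obtain P where P: "P \<subseteq> {..<n} \<times> {..<n}" "real (card P) \<le> \<kappa> * real e"
      "H \<in> range (pattern P)" "H \<subseteq> {(i, j). i < j \<and> j < n}"
      by (auto simp: sparse_patterns_def)
    have "card P \<le> N"
      using P(2) by (simp add: N_def le_nat_floor)
    then show "H \<in> (\<Union>P\<in>\<P>. \<Q> P)"
      using P by (auto simp: \<P>_def \<Q>_def)
  qed
  then show "finite (sparse_patterns n \<kappa> e)"
    using fin finQ finite_subset by blast
  have "card (sparse_patterns n \<kappa> e) \<le> card (\<Union>P\<in>\<P>. \<Q> P)"
    using sub fin finQ by (intro card_mono) auto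
  also have "\<dots> \<le> (\<Sum>P\<in>\<P>. card (\<Q> P))"
    using fin by (rule card_UN_le)
  also have "\<dots> \<le> (\<Sum>P\<in>\<P>. (n ^ 4) ^ N)"
    by (intro sum_mono cardQ)
  also have "\<dots> = card \<P> * (n ^ 4) ^ N"
    by simp
  also have "\<dots> \<le> (n ^ 3) ^ N * (n ^ 4) ^ N"
  proof (rule mult_le_mono1)
    have "card ({..<n} \<times> {..<n}) + 1 \<le> n ^ 3"
    proof -
      obtain k where "n = k + 2"
        using assms(1) by (metis add.commute le_Suc_ex)
      then show ?thesis
        by (simp add: power3_eq_cube algebra_simps)
    qed
    then have "(card ({..<n} \<times> {..<n}) + 1) ^ N \<le> (n ^ 3) ^ N"
      by (intro power_mono) auto
    with cardP show "card \<P> \<le> (n ^ 3) ^ N"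
      by (rule order_trans)
  qed
  also have "\<dots> = n ^ (7 * N)"
    by (simp add: power_mult[symmetric] power_add[symmetric])
  finally have "real (card (sparse_patterns n \<kappa> e)) \<le> real n ^ (7 * N)"
    by (metis of_nat_le_iff of_nat_power)
  also have "\<dots> = exp (real (7 * N) * ln (real n))"
    unfolding exp_of_nat_mult using assms(1) by simp
  also have "\<dots> \<le> exp (7 * \<kappa> * real e * ln (real n))"
  proof -
    have "real N \<le> \<kappa> * real e"
      using assms(2) by (simp add: N_def)
    then have "real (7 * N) * ln (real n) \<le> (7 * \<kappa> * real e) * ln (real n)"
      using assms(1) by (intro mult_right_mono) auto
    then show ?thesis by simp
  qed
  finally show "real (card (sparse_patterns n \<kappa> e)) \<le> exp (7 * \<kappa> * real e * ln (real n))" .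
qed

text \<open>The threshold \<beta> replaces the unknown dimension, so the family of candidates does
  not depend on the graph.\<close>

lemma small_orth_dim_pattern:
  assumes "0 < n" "0 < \<beta>" "2 * \<beta> \<le> real n" "real (orth_dim n (graph_of n f)) < \<beta>"
  obtains H where "H \<in> sparse_patterns n (4 * \<beta> / real n) (card H)" "real n \<le> 4 * \<beta> * real (card H)"
    "\<And>h. h \<in> H \<Longrightarrow> f h"
proof -
  define d where "d = orth_dim n (graph_of n f)"
  obtain v where v: "orth_rep n (graph_of n f) d v"
    using orth_rep_orth_dim unfolding d_def by blast
  have d: "real d \<le> \<beta>"
    using assms(4) by (simp add: d_def)
  then have "2 * d \<le> n"
    using assms(3) by linarith
  obtain P H where P: "P \<subseteq> {..<n} \<times> {..<n}" "H \<in> range (pattern P)"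
    "n * card P \<le> 4 * d * card H" "n \<le> 4 * d * card H"
    "H \<subseteq> {(i, j). i < j \<and> j < n \<and> {i, j} \<in> graph_of n f}"
    by (rule orth_rep_pattern[OF assms(1) \<open>2 * d \<le> n\<close> v])
  have dH: "4 * real d * real (card H) \<le> 4 * \<beta> * real (card H)"
    using d by (intro mult_right_mono) auto
  have "real (n * card P) \<le> real (4 * d * card H)" "real n \<le> real (4 * d * card H)"
    using P(3,4) by (simp_all only: of_nat_le_iff)
  then have 1: "real n * real (card P) \<le> 4 * \<beta> * real (card H)" and 2: "real n \<le> 4 * \<beta> * real (card H)"
    using dH by simp_all
  from 1 have "real (card P) \<le> 4 * \<beta> / real n * real (card H)"
    using assms(1) by (simp add: field_simps)
  then have "H \<in> sparse_patterns n (4 * \<beta> / real n) (card H)"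
    using P(1,2,5) by (auto simp: sparse_patterns_def)
  moreover have "f h" if "h \<in> H" for h
    using P(5) that graph_of_iff[of _ _ n f] by auto
  ultimately show ?thesis
    using 2 that by blast
qed

lemma prob_small_orth_dim_le:
  assumes n: "2 \<le> n" and p: "1 / real n \<le> p" "p < 1"
  shows "measure_pmf.prob (edge_pmf n p)
    {f. real (orth_dim n (graph_of n f)) < (1 / 56) * real n * ln (1 / p) / ln (real n)} \<le> 1 / real n ^ 5"
proof -
  define L where "L = ln (1 / p)"
  define \<beta> where "\<beta> = (1 / 56) * real n * L / ln (real n)"
  have p0: "0 < p"
    using n p(1) by (smt (verit) divide_pos_pos of_nat_0_less_iff zero_less_one order_less_le_trans zero_less_numeral)
  have lnn: "0 < ln (real n)"
    using n by simp
  \<comment> \<open>The hypothesis \<open>1 / real n \<le> p\<close> enters here; it keeps \<beta>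
    below \<open>n / 2\<close>, as the pattern lemma requires.\<close>
  have L: "0 < L" "L \<le> ln (real n)"
  proof -
    show "0 < L"
      using p0 p(2) by (simp add: L_def)
    have "1 / p \<le> real n"
      using p(1) p0 n by (simp add: field_simps)
    then show "L \<le> ln (real n)"
      unfolding L_def using p0 n by (intro iffD2[OF ln_le_cancel_iff]) auto
  qed
  have p_exp: "p ^ e = exp (- (L * real e))" for e
    using p0 by (simp add: L_def ln_div exp_of_nat_mult[symmetric] mult.commute exp_of_nat_mult)
  have \<beta>: "0 < \<beta>" "2 * \<beta> \<le> real n"
  proof -
    show "0 < \<beta>"
      using n L lnn by (simp add: \<beta>_def)
    have "real n * L \<le> real n * ln (real n)"
      using L by (intro mult_left_mono) auto
    then have "real n * L / ln (real n) \<le> real n"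
      using lnn by (simp add: divide_le_eq)
    then have "1 / 28 * (real n * L / ln (real n)) \<le> 1 * real n"
      using L lnn by (intro mult_mono) auto
    then show "2 * \<beta> \<le> real n"
      by (simp add: \<beta>_def mult.commute)
  qed
  define \<kappa> where "\<kappa> = 4 * \<beta> / real n"
  define M where "M = edge_pmf n p"
  define I where "I = {e \<in> {1..n\<^sup>2}. real n \<le> 4 * \<beta> * real e}"
  have "{f. real (orth_dim n (graph_of n f)) < \<beta>} \<subseteq>
    (\<Union>e\<in>I. \<Union>H\<in>sparse_patterns n \<kappa> e. {f. \<forall>h\<in>H. f h})"
  proof
    fix f assume "f \<in> {f. real (orth_dim n (graph_of n f)) < \<beta>}"
    then have "real (orth_dim n (graph_of n f)) < \<beta>" by simp
    then obtain H where H: "H \<in> sparse_patterns n \<kappa> (card H)" "real n \<le> 4 * \<beta> * real (card H)"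
      "\<And>h. h \<in> H \<Longrightarrow> f h"
      unfolding \<kappa>_def using n \<beta> by (rule_tac small_orth_dim_pattern[of n \<beta> f]) auto
    have "card H \<noteq> 0"
      using H(2) n by (intro notI) simp
    moreover have "card H \<le> n\<^sup>2"
    proof -
      have "H \<subseteq> {..<n} \<times> {..<n}"
        using H(1) by (fastforce simp: sparse_patterns_def)
      then have "card H \<le> card ({..<n} \<times> {..<n})"
        by (intro card_mono) auto
      then show ?thesis
        by (simp add: power2_eq_square)
    qed
    ultimately have "card H \<in> I"
      using H(2) by (simp add: I_def Suc_le_eq)
    then show "f \<in> (\<Union>e\<in>I. \<Union>H\<in>sparse_patterns n \<kappa> e. {f. \<forall>h\<in>H. f h})"
      using H(1,3) by blast
  qed
  then have "measure_pmf.prob M {f. real (orth_dim n (graph_of n f)) < \<beta>} \<le>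
    measure_pmf.prob M (\<Union>e\<in>I. \<Union>H\<in>sparse_patterns n \<kappa> e. {f. \<forall>h\<in>H. f h})"
    by (intro measure_pmf.finite_measure_mono) auto
  also have "\<dots> \<le> (\<Sum>e\<in>I. measure_pmf.prob M (\<Union>H\<in>sparse_patterns n \<kappa> e. {f. \<forall>h\<in>H. f h}))"
    by (intro measure_pmf.finite_measure_subadditive_finite) (auto simp: I_def)
  also have "\<dots> \<le> (\<Sum>e\<in>I. 1 / real n ^ 7)"
  proof (rule sum_mono)
    fix e assume e: "e \<in> I"
    have \<kappa>0: "0 \<le> \<kappa>"
      using \<beta> by (simp add: \<kappa>_def)
    have "measure_pmf.prob M (\<Union>H\<in>sparse_patterns n \<kappa> e. {f. \<forall>h\<in>H. f h}) \<le>
      (\<Sum>H\<in>sparse_patterns n \<kappa> e. measure_pmf.prob M {f. \<forall>h\<in>H. f h})"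
      using card_sparse_patterns_le(1)[OF n \<kappa>0]
      by (intro measure_pmf.finite_measure_subadditive_finite) auto
    also have "\<dots> = (\<Sum>H\<in>sparse_patterns n \<kappa> e. p ^ e)"
      using p0 p(2) finite_pairs unfolding M_def edge_pmf_def
      by (intro sum.cong refl) (subst prob_all_edges, auto simp: sparse_patterns_def)
    also have "\<dots> = real (card (sparse_patterns n \<kappa> e)) * p ^ e"
      by simp
    also have "\<dots> \<le> exp (7 * \<kappa> * real e * ln (real n)) * p ^ e"
      using p0 card_sparse_patterns_le(2)[OF n \<kappa>0] by (intro mult_right_mono) auto
    \<comment> \<open>The constant 1/56 is chosen for this: counting the patterns costs exactly half
      of the exponent that \<open>p ^ e\<close> supplies.\<close>
    also have "7 * \<kappa> * real e * ln (real n) = L * real e / 2"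
      using n lnn by (simp add: \<kappa>_def \<beta>_def)
    also have "exp (L * real e / 2) * p ^ e = exp (- (L * real e / 2))"
      unfolding p_exp exp_add[symmetric] by simp
    \<comment> \<open>The lower bound on \<open>e\<close> in \<open>I\<close> says
      \<open>L * e\<close> is at least \<open>14 * ln n\<close>. Each \<open>e\<close> then
      contributes at most \<open>n ^ -7\<close>, and there are at most \<open>n\<^sup>2\<close>
      values of \<open>e\<close>.\<close>
    also have "\<dots> \<le> exp (- (7 * ln (real n)))"
    proof -
      have "real n \<le> 4 * \<beta> * real e"
        using e by (simp add: I_def)
      also have "4 * \<beta> * real e = real n * (L * real e / (14 * ln (real n)))"
        by (simp add: \<beta>_def)
      finally have "real n * 1 \<le> real n * (L * real e / (14 * ln (real n)))"
        by simp
      then have "1 \<le> L * real e / (14 * ln (real n))"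
        by (rule mult_left_le_imp_le) (use n in simp)
      then show ?thesis
        using lnn by (simp add: field_simps)
    qed
    also have "\<dots> = 1 / real n ^ 7"
    proof -
      have "exp (7 * ln (real n)) = exp (ln (real n)) ^ 7"
        by (simp add: exp_of_nat_mult[of 7, simplified])
      then show ?thesis
        using n by (simp add: exp_minus field_simps)
    qed
    finally show "measure_pmf.prob M (\<Union>H\<in>sparse_patterns n \<kappa> e. {f. \<forall>h\<in>H. f h}) \<le> 1 / real n ^ 7" .
  qed
  also have "\<dots> \<le> real (n\<^sup>2) * (1 / real n ^ 7)"
  proof -
    have "card I \<le> card {1..n\<^sup>2}"
      unfolding I_def by (intro card_mono) auto
    then have "real (card I) \<le> real (n\<^sup>2)"
      by (simp only: of_nat_le_iff card_atLeastAtMost)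
    then show ?thesis
      by (simp only: sum_constant) (intro mult_right_mono, auto)
  qed
  also have "\<dots> = 1 / real n ^ 5"
    using n by (simp add: field_simps power_add[symmetric])
  finally show ?thesis
    by (simp add: M_def \<beta>_def L_def)
qed

section \<open>The upper bound\<close>

lemma prob_pair_pmf_Times:
  "measure_pmf.prob (pair_pmf M N) (A \<times> B) = measure_pmf.prob M A * measure_pmf.prob N B"
proof -
  have "measure_pmf.prob (pair_pmf M N) (A \<times> B) =
      measure_pmf.prob (pair_pmf M N) ((A \<inter> set_pmf M) \<times> (B \<inter> set_pmf N))"
    by (subst measure_Int_set_pmf[symmetric]) (simp add: Times_Int_Times)
  also have "\<dots> = measure_pmf.prob M (A \<inter> set_pmf M) * measure_pmf.prob N (B \<inter> set_pmf N)"
    by (intro measure_pmf_prob_product countable_Int2 countable_set_pmf)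
  finally show ?thesis
    by (simp add: measure_Int_set_pmf)
qed

text \<open>Conditioning on the first coordinate: a bound uniform in \<open>x\<close> survives
  averaging. It allows the edges among old vertices to be fixed while those to a new vertex stay
  random.\<close>

lemma prob_pair_pmf_le:
  assumes "\<And>x. measure_pmf.prob N {y. R x y} \<le> \<delta>" "0 \<le> \<delta>"
  shows "measure_pmf.prob (pair_pmf M N) {(x, y). R x y} \<le> \<delta>"
proof -
  have "emeasure (measure_pmf (pair_pmf M N)) {(x, y). R x y} =
      (\<integral>\<^sup>+ x. emeasure (measure_pmf N) {y. R x y} \<partial>M)"
  proof -
    have "pair_pmf M N = bind_pmf M (\<lambda>x. map_pmf (Pair x) N)"
      by (simp add: pair_pmf_def map_pmf_def)
    then show ?thesis
      by (simp add: vimage_def)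
  qed
  also have "\<dots> \<le> (\<integral>\<^sup>+ x. ennreal \<delta> \<partial>M)"
    by (intro nn_integral_mono) (simp add: measure_pmf.emeasure_eq_measure ennreal_leI assms(1))
  also have "\<dots> = ennreal \<delta>"
    by simp
  finally show ?thesis
    using assms(2) by (simp add: measure_pmf.emeasure_eq_measure)
qed

text \<open>Disjoint classes use disjoint sets of independent indicators. Splitting off one class at
  a time gives the product, and a class has no miss with probability
  \<open>p ^ card (C a)\<close>.\<close>

lemma prob_each_class_misses:
  fixes C :: "'c \<Rightarrow> 'e set"
  assumes "finite K" "\<And>a. a \<in> K \<Longrightarrow> finite (C a)" "disjoint_family_on C K" "0 \<le> p" "p \<le> 1"
  shows "measure_pmf.prob (Pi_pmf (\<Union>a\<in>K. C a) False (\<lambda>_. bernoulli_pmf p)) {g. \<forall>a\<in>K. \<exists>x\<in>C a. \<not> g x}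
    = (\<Prod>a\<in>K. 1 - p ^ card (C a))"
  using assms(1-3)
proof (induction K rule: finite_induct)
  case empty
  show ?case by simp
next
  case (insert a K)
  define U where "U = (\<Union>b\<in>K. C b)"
  have fin: "finite (C a)" "finite U"
    using insert by (auto simp: U_def)
  have disj: "C a \<inter> U = {}"
    using insert by (fastforce simp: U_def disjoint_family_on_def)
  define M where "M = Pi_pmf (C a) False (\<lambda>_. bernoulli_pmf p)"
  define N where "N = Pi_pmf U False (\<lambda>_. bernoulli_pmf p)"
  define h :: "('e \<Rightarrow> bool) \<times> ('e \<Rightarrow> bool) \<Rightarrow> 'e \<Rightarrow> bool"
    where "h = (\<lambda>(f, g) x. if x \<in> C a then f x else g x)"
  have "Pi_pmf (\<Union>b\<in>insert a K. C b) False (\<lambda>_. bernoulli_pmf p) = map_pmf h (pair_pmf M N)"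
    unfolding UN_insert U_def[symmetric] M_def N_def h_def by (rule Pi_pmf_union[OF fin disj])
  then have "measure_pmf.prob (Pi_pmf (\<Union>b\<in>insert a K. C b) False (\<lambda>_. bernoulli_pmf p))
      {g. \<forall>b\<in>insert a K. \<exists>x\<in>C b. \<not> g x} =
      measure_pmf.prob (pair_pmf M N) (h -` {g. \<forall>b\<in>insert a K. \<exists>x\<in>C b. \<not> g x})"
    by simp
  also have "h -` {g. \<forall>b\<in>insert a K. \<exists>x\<in>C b. \<not> g x} =
      {f. \<exists>x\<in>C a. \<not> f x} \<times> {g. \<forall>b\<in>K. \<exists>x\<in>C b. \<not> g x}"
  proof -
    have nin: "x \<notin> C a" if "b \<in> K" "x \<in> C b" for b x
      using that disj by (auto simp: U_def)
    have "(\<exists>x\<in>C b. \<not> h (f, g) x) \<longleftrightarrow> (\<exists>x\<in>C b. \<not> g x)" if "b \<in> K" for b f g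
      using nin[OF that] by (auto simp: h_def)
    moreover have "(\<exists>x\<in>C a. \<not> h (f, g) x) \<longleftrightarrow> (\<exists>x\<in>C a. \<not> f x)" for f g
      by (auto simp: h_def)
    ultimately show ?thesis
      by (simp add: set_eq_iff cong: ball_cong)
  qed
  also have "measure_pmf.prob (pair_pmf M N) \<dots> =
      measure_pmf.prob M {f. \<exists>x\<in>C a. \<not> f x} * measure_pmf.prob N {g. \<forall>b\<in>K. \<exists>x\<in>C b. \<not> g x}"
    by (rule prob_pair_pmf_Times)
  also have "measure_pmf.prob N {g. \<forall>b\<in>K. \<exists>x\<in>C b. \<not> g x} = (\<Prod>b\<in>K. 1 - p ^ card (C b))"
    unfolding N_def U_def using insert by (intro insert.IH) (auto simp: disjoint_family_on_def)
  also have "measure_pmf.prob M {f. \<exists>x\<in>C a. \<not> f x} = 1 - p ^ card (C a)"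
  proof -
    have "{f. \<exists>x\<in>C a. \<not> f x} = UNIV - {f. \<forall>x\<in>C a. f x}"
      by auto
    moreover have "measure_pmf.prob M {f. \<forall>x\<in>C a. f x} = p ^ card (C a)"
      unfolding M_def using fin assms(4,5) by (intro prob_all_edges) auto
    ultimately show ?thesis
      using measure_pmf.prob_compl[of "{f. \<forall>x\<in>C a. f x}" M] by simp
  qed
  finally show ?case
    using insert by simp
qed

definition clique_cover :: "nat \<Rightarrow> nat \<Rightarrow> (nat \<times> nat \<Rightarrow> bool) \<Rightarrow> (nat \<Rightarrow> nat) \<Rightarrow> bool" where
  "clique_cover n K f c \<longleftrightarrow> (\<forall>i<n. c i < K) \<and> (\<forall>i j. i < j \<and> j < n \<and> c i = c j \<longrightarrow> f (i, j))"

text \<open>The tangent of \<open>exp\<close> at \<open>- L * n0 / K\<close> replaces Jensen's inequality.\<close>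

lemma prod_class_misses_le:
  assumes "0 < p" "p \<le> 1" "0 < K" "(\<Sum>a<K. s a) \<le> n0"
  shows "(\<Prod>a<K. 1 - p ^ s a) \<le> exp (- (real K * exp (- (ln (1 / p) * real n0 / real K))))"
proof -
  define L where "L = ln (1 / p)"
  define m where "m = real n0 / real K"
  have L: "0 \<le> L"
    using assms by (simp add: L_def)
  have p_exp: "p ^ k = exp (- (L * real k))" for k
    using assms(1) by (simp add: L_def ln_div exp_of_nat_mult[symmetric] mult.commute exp_of_nat_mult)
  have tangent: "exp (- (L * m)) * (1 - L * (real k - m)) \<le> p ^ k" for k
  proof -
    have "1 - L * (real k - m) \<le> exp (- (L * (real k - m)))"
      using exp_ge_add_one_self[of "- (L * (real k - m))"] by simp
    then have "exp (- (L * m)) * (1 - L * (real k - m)) \<le> exp (- (L * m)) * exp (- (L * (real k - m)))"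
      by (intro mult_left_mono) auto
    also have "\<dots> = p ^ k"
      unfolding p_exp exp_add[symmetric] by (simp add: algebra_simps)
    finally show ?thesis .
  qed
  have "real K * m = real n0"
    using assms(3) by (simp add: m_def)
  have "(\<Sum>a<K. real (s a)) \<le> real n0"
    using assms(4) by (simp only: of_nat_sum[symmetric] of_nat_le_iff)
  then have "L * (\<Sum>a<K. real (s a)) \<le> L * real n0"
    using L by (rule mult_left_mono)
  \<comment> \<open>The tangent has slope of sign opposite to \<open>L\<close>, so class sizes
    summing to less than \<open>n0\<close> only increase the sum of the tangent values.\<close>
  have "real K * exp (- (L * m)) \<le> exp (- (L * m)) * (real K - L * ((\<Sum>a<K. real (s a)) - real n0))"
  proof -
    have "real K \<le> real K - L * ((\<Sum>a<K. real (s a)) - real n0)"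
      using \<open>L * (\<Sum>a<K. real (s a)) \<le> L * real n0\<close> by (simp add: algebra_simps)
    then show ?thesis
      by (subst mult.commute) (rule mult_left_mono, auto)
  qed
  also have "real K - L * ((\<Sum>a<K. real (s a)) - real n0) = (\<Sum>a<K. 1 - L * (real (s a) - m))"
    by (simp add: sum_subtractf sum_distrib_left[symmetric] \<open>real K * m = real n0\<close>)
  also have "exp (- (L * m)) * \<dots> = (\<Sum>a<K. exp (- (L * m)) * (1 - L * (real (s a) - m)))"
    by (rule sum_distrib_left)
  also have "\<dots> \<le> (\<Sum>a<K. p ^ s a)"
    by (intro sum_mono tangent)
  finally have sum: "real K * exp (- (L * m)) \<le> (\<Sum>a<K. p ^ s a)" .
  have "(\<Prod>a<K. 1 - p ^ s a) \<le> (\<Prod>a<K. exp (- (p ^ s a)))"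
  proof (intro prod_mono conjI)
    fix a
    show "0 \<le> 1 - p ^ s a"
      using assms by (simp add: power_le_one)
    show "1 - p ^ s a \<le> exp (- (p ^ s a))"
      using exp_ge_add_one_self[of "- (p ^ s a)"] by simp
  qed
  also have "\<dots> = exp (- (\<Sum>a<K. p ^ s a))"
    by (simp add: exp_sum flip: sum_negf)
  also have "\<dots> \<le> exp (- (real K * exp (- (L * m))))"
    using sum by simp
  finally show ?thesis
    by (simp add: L_def m_def)
qed

text \<open>A clique cover of the first \<open>n\<close> vertices that does not extend to vertex \<open>n\<close> has in each
  class a non-neighbour of \<open>n\<close>, and these events are independent over the classes.\<close>

lemma prob_no_clique_cover_le:
  assumes p: "0 < p" "p \<le> 1" and "0 < K" "n \<le> n0"
  shows "measure_pmf.prob (edge_pmf n p) {f. \<nexists>c. clique_cover n K f c}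
    \<le> real n * exp (- (real K * exp (- (ln (1 / p) * real n0 / real K))))"
  using assms(4)
proof (induction n)
  case 0
  then show ?case by (simp add: clique_cover_def)
next
  case (Suc n)
  \<comment> \<open>It depends on the fixed \<open>n0\<close> and not on \<open>n\<close>, so every
    added vertex costs the same.\<close>
  define \<delta> where "\<delta> = exp (- (real K * exp (- (ln (1 / p) * real n0 / real K))))"
  define A where "A = {(i, j). i < j \<and> j < n}"
  define T where "T = (\<lambda>i. (i, n)) ` {..<n}"
  have fin: "finite A" "finite T"
    by (simp_all add: A_def T_def finite_pairs)
  have disj: "A \<inter> T = {}"
    by (auto simp: A_def T_def)
  define M where "M = edge_pmf n p"
  define N where "N = Pi_pmf T False (\<lambda>_. bernoulli_pmf p)"
  define h :: "(nat \<times> nat \<Rightarrow> bool) \<times> (nat \<times> nat \<Rightarrow> bool) \<Rightarrow> nat \<times> nat \<Rightarrow> bool"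
    where "h = (\<lambda>(f, g) x. if x \<in> A then f x else g x)"
  \<comment> \<open>The chosen cover is a function of the old edges \<open>f\<close> only, hence
    independent of the edges \<open>g\<close> to the new vertex.\<close>
  define col where "col f = (SOME c. clique_cover n K f c)" for f
  have col: "clique_cover n K f (col f)" if "\<exists>c. clique_cover n K f c" for f
    unfolding col_def using that by (rule someI_ex)
  define R where "R f g \<longleftrightarrow> (\<exists>c. clique_cover n K f c) \<and> (\<forall>a<K. \<exists>i<n. col f i = a \<and> \<not> g (i, n))" for f g
  have "{(i, j). i < j \<and> j < Suc n} = A \<union> T"
    by (auto simp: A_def T_def less_Suc_eq image_iff)
  then have "edge_pmf (Suc n) p = map_pmf h (pair_pmf M N)"
    unfolding edge_pmf_def M_def N_def h_def A_def[symmetric] by (simp only: Pi_pmf_union[OF fin disj])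
  then have "measure_pmf.prob (edge_pmf (Suc n) p) {f. \<nexists>c. clique_cover (Suc n) K f c} =
      measure_pmf.prob (pair_pmf M N) (h -` {f. \<nexists>c. clique_cover (Suc n) K f c})"
    by simp
  also have "\<dots> \<le> measure_pmf.prob (pair_pmf M N)
      ({f. \<nexists>c. clique_cover n K f c} \<times> UNIV \<union> {(f, g). R f g})"
  proof (intro measure_pmf.finite_measure_mono subsetI)
    fix fg assume fg: "fg \<in> h -` {f. \<nexists>c. clique_cover (Suc n) K f c}"
    obtain f g where fg_eq: "fg = (f, g)" by (cases fg)
    show "fg \<in> {f. \<nexists>c. clique_cover n K f c} \<times> UNIV \<union> {(f, g). R f g}"
    proof (rule ccontr)
      assume "\<not> ?thesis"
      then have ex: "\<exists>c. clique_cover n K f c" and "\<not> R f g"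
        by (auto simp: fg_eq)
      then obtain a where a: "a < K" "\<And>i. i < n \<Longrightarrow> col f i = a \<Longrightarrow> g (i, n)"
        by (auto simp: R_def)
      have cc: "\<And>i. i < n \<Longrightarrow> col f i < K" "\<And>i j. i < j \<Longrightarrow> j < n \<Longrightarrow> col f i = col f j \<Longrightarrow> f (i, j)"
        using col[OF ex] by (auto simp: clique_cover_def)
      \<comment> \<open>The new vertex joins class \<open>a\<close>, to all of whose members it is
        adjacent.\<close>
      have "clique_cover (Suc n) K (h (f, g)) ((col f)(n := a))"
        unfolding clique_cover_def
      proof (intro conjI allI impI)
        fix i assume "i < Suc n"
        then show "((col f)(n := a)) i < K"
          using a(1) cc(1) by (auto simp: less_Suc_eq)
      next
        fix i j assume ij: "i < j \<and> j < Suc n \<and> ((col f)(n := a)) i = ((col f)(n := a)) j"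
        show "h (f, g) (i, j)"
        proof (cases "j = n")
          case True
          then have "g (i, n)" "(i, j) \<notin> A"
            using ij a(2) by (auto simp: A_def)
          then show ?thesis
            using True by (simp add: h_def)
        next
          case False
          then have "f (i, j)" "(i, j) \<in> A"
            using ij cc(2) by (auto simp: A_def)
          then show ?thesis
            by (simp add: h_def)
        qed
      qed
      then show False
        using fg by (auto simp: fg_eq)
    qed
  qed simp
  also have "\<dots> \<le> measure_pmf.prob (pair_pmf M N) ({f. \<nexists>c. clique_cover n K f c} \<times> UNIV) +
      measure_pmf.prob (pair_pmf M N) {(f, g). R f g}"
    by (intro measure_Un_le) auto
  also have "measure_pmf.prob (pair_pmf M N) ({f. \<nexists>c. clique_cover n K f c} \<times> UNIV) =
      measure_pmf.prob M {f. \<nexists>c. clique_cover n K f c}"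
    by (simp add: prob_pair_pmf_Times)
  also have "\<dots> \<le> real n * \<delta>"
    unfolding M_def \<delta>_def using Suc by simp
  also have "measure_pmf.prob (pair_pmf M N) {(f, g). R f g} \<le> \<delta>"
  proof (rule prob_pair_pmf_le)
    fix f
    show "measure_pmf.prob N {g. R f g} \<le> \<delta>"
    proof (cases "\<exists>c. clique_cover n K f c")
      case False
      then show ?thesis
        by (simp add: R_def \<delta>_def)
    next
      case True
      define C where "C a = (\<lambda>i. (i, n)) ` {i. i < n \<and> col f i = a}" for a
      have colK: "col f i < K" if "i < n" for i
        using col[OF True] that by (auto simp: clique_cover_def)
      have T: "T = (\<Union>a\<in>{..<K}. C a)"
        using colK by (auto simp: T_def C_def)
      have "{g. R f g} = {g. \<forall>a\<in>{..<K}. \<exists>x\<in>C a. \<not> g x}"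
        using True by (auto simp: R_def C_def)
      then have "measure_pmf.prob N {g. R f g} = (\<Prod>a<K. 1 - p ^ card (C a))"
        unfolding N_def T using p prob_each_class_misses[of "{..<K}" C p]
        by (auto simp: C_def disjoint_family_on_def)
      also have "\<dots> \<le> \<delta>"
        unfolding \<delta>_def
      proof (rule prod_class_misses_le)
        have "(\<Sum>a<K. card (C a)) = card (\<Union>a\<in>{..<K}. C a)"
          by (rule card_UN_disjoint[symmetric]) (auto simp: C_def)
        also have "\<dots> = n"
          unfolding T[symmetric] T_def by (subst card_image) (auto simp: inj_on_def)
        finally show "(\<Sum>a<K. card (C a)) \<le> n0"
          using Suc.prems by simp
      qed (use p \<open>0 < K\<close> in auto)
      finally show ?thesis .
    qed
  qed (simp add: \<delta>_def)
  finally show ?case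
    by (simp add: \<delta>_def algebra_simps)
qed

text \<open>Each vertex gets the basis vector of its class; nonadjacent vertices lie in different
  classes.\<close>

lemma orth_dim_le_clique_cover:
  assumes "clique_cover n K f c"
  shows "orth_dim n (graph_of n f) \<le> K"
proof -
  have "orth_rep n (graph_of n f) K (\<lambda>i k. if k = c i then 1 else 0)"
    unfolding orth_rep_def
  proof (intro conjI allI impI)
    fix i assume "i < n"
    then show "\<exists>k<K. (if k = c i then 1 else 0 :: real) \<noteq> 0"
      using assms by (auto simp: clique_cover_def)
  next
    fix i j assume "i < n" "j < n" and ij: "i \<noteq> j \<and> {i, j} \<notin> graph_of n f"
    have "c i \<noteq> c j"
    proof (cases "i < j")
      case True
      then show ?thesis
        using assms ij \<open>j < n\<close> by (auto simp: clique_cover_def graph_of_iff)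
    next
      case False
      then have "j < i" "{j, i} \<notin> graph_of n f"
        using ij by (auto simp: insert_commute)
      then have "\<not> f (j, i)"
        using \<open>i < n\<close> by (simp add: graph_of_iff)
      then show ?thesis
        using assms \<open>j < i\<close> \<open>i < n\<close> unfolding clique_cover_def by metis
    qed
    then show "(\<Sum>k<K. (if k = c i then 1 else 0) * (if k = c j then 1 else 0 :: real)) = 0"
      by (intro sum.neutral) auto
  qed
  then show ?thesis
    unfolding orth_dim_def by (intro Least_le) blast
qed

text \<open>With about \<open>800 * n * L / ln n\<close> classes, a vertex fails to be placed with
  probability at most \<open>n ^ -2\<close>, and there are \<open>n\<close> vertices.\<close>

lemma prob_large_orth_dim_le:
  assumes n: "2 \<le> n" and p: "0 < p" "p \<le> 1 - real n powr (-0.99)"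
    and large: "2 \<le> 800 * real n powr 0.01 / ln (real n)"
      "2 * ln (real n) \<le> 400 * real n powr 0.01 / ln (real n) * real n powr (-1 / 400)"
  shows "measure_pmf.prob (edge_pmf n p)
    {f. 800 * real n * ln (1 / p) / ln (real n) < real (orth_dim n (graph_of n f))} \<le> 1 / real n"
proof -
  define L where "L = ln (1 / p)"
  define x where "x = 800 * real n * L / ln (real n)"
  \<comment> \<open>Rounding down costs at most a factor 2 because \<open>x\<close> is at least 2,
    so 800 becomes 400 below.\<close>
  define K where "K = nat \<lfloor>x\<rfloor>"
  have lnn: "0 < ln (real n)"
    using n by simp
  have "p \<le> 1"
    using p(2) by (smt (verit) powr_ge_zero)
  \<comment> \<open>From \<open>ln p \<le> p - 1\<close>, the value \<open>L\<close> is at least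
    \<open>1 - p\<close>. This is where the upper bound on \<open>p\<close> is needed: it makes the
    number of classes grow like a power of \<open>n\<close>.\<close>
  have "real n powr (-0.99) \<le> L"
    using p ln_le_minus_one[of p] by (simp add: L_def ln_div)
  then have "real n * real n powr (-0.99) \<le> real n * L"
    by (rule mult_left_mono) simp
  moreover have "real n * real n powr (-0.99) = real n powr 0.01"
    using n powr_add[of "real n" 1 "-0.99"] by simp
  ultimately have nL: "real n powr 0.01 \<le> real n * L"
    by simp
  have "800 * real n powr 0.01 / ln (real n) \<le> 800 * (real n * L) / ln (real n)"
    using nL lnn by (intro divide_right_mono mult_left_mono) auto
  then have x: "800 * real n powr 0.01 / ln (real n) \<le> x"
    by (simp add: x_def mult.assoc)
  then have "2 \<le> x"
    using large(1) by simp
  then have "real K = of_int \<lfloor>x\<rfloor>"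
    by (simp add: K_def)
  moreover have "of_int \<lfloor>x\<rfloor> \<le> x" "x < of_int \<lfloor>x\<rfloor> + 1"
    by (rule of_int_floor_le, rule floor_correct[THEN conjunct2, simplified])
  ultimately have K: "real K \<le> x" "x / 2 \<le> real K"
    using \<open>2 \<le> x\<close> by linarith+
  then have "0 < K"
    using \<open>2 \<le> x\<close> by (intro Nat.gr0I) simp
  have "0 < real n powr 0.01"
    using n by simp
  then have "0 < real n * L"
    using nL by linarith
  then have "0 < L"
    using n by (simp add: zero_less_mult_iff)
  have "L * real n / real K \<le> L * real n / (x / 2)"
    using K \<open>0 < K\<close> \<open>0 < L\<close> \<open>2 \<le> x\<close> by (intro divide_left_mono) auto
  also have "\<dots> = ln (real n) / 400"
    using n \<open>0 < L\<close> lnn by (simp add: x_def field_simps)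
  finally have "exp (- (ln (real n) / 400)) \<le> exp (- (L * real n / real K))"
    by simp
  moreover have "exp (- (ln (real n) / 400)) = real n powr (-1 / 400)"
    using n by (simp add: powr_def)
  ultimately have e: "real n powr (-1 / 400) \<le> exp (- (L * real n / real K))"
    by simp
  have "400 * real n powr 0.01 / ln (real n) \<le> real K"
    using x K(2) by simp
  then have "400 * real n powr 0.01 / ln (real n) * real n powr (-1 / 400) \<le>
      real K * exp (- (L * real n / real K))"
    using e by (intro mult_mono) auto
  then have main: "2 * ln (real n) \<le> real K * exp (- (L * real n / real K))"
    using large(2) by linarith
  have "{f. x < real (orth_dim n (graph_of n f))} \<subseteq> {f. \<nexists>c. clique_cover n K f c}"
  proof safe
    fix f c assume "x < real (orth_dim n (graph_of n f))" "clique_cover n K f c"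
    then show False
      using orth_dim_le_clique_cover[of n K f c] K(1) by linarith
  qed
  then have "measure_pmf.prob (edge_pmf n p) {f. x < real (orth_dim n (graph_of n f))} \<le>
      measure_pmf.prob (edge_pmf n p) {f. \<nexists>c. clique_cover n K f c}"
    by (intro measure_pmf.finite_measure_mono) auto
  also have "\<dots> \<le> real n * exp (- (real K * exp (- (L * real n / real K))))"
    unfolding L_def using p(1) \<open>p \<le> 1\<close> \<open>0 < K\<close> by (intro prob_no_clique_cover_le) auto
  also have "\<dots> \<le> real n * exp (- (2 * ln (real n)))"
    using main by (intro mult_left_mono) auto
  also have "exp (- (2 * ln (real n))) = 1 / real n ^ 2"
    using n exp_of_nat_mult[of 2 "ln (real n)"] by (simp add: exp_minus field_simps)
  also have "real n * (1 / real n ^ 2) = 1 / real n"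
    by (simp add: power2_eq_square)
  finally show ?thesis
    by (simp add: x_def L_def)
qed

theorem theorem4p1:
  shows "\<exists>c C :: real. 0 < c \<and> c < C \<and>
    (\<forall>p :: nat \<Rightarrow> real.
      (\<forall>\<^sub>F n in sequentially. 1 / real n \<le> p n \<and> p n \<le> 1 - real n powr (-0.99)) \<longrightarrow>
      ((\<lambda>n. measure_pmf.prob (gnp n (p n))
          {E. c * real n * ln (1 / p n) / ln (real n) \<le> real (orth_dim n E) \<and>
              real (orth_dim n E) \<le> C * real n * ln (1 / p n) / ln (real n)})
        \<longlonglongrightarrow> 1))"
proof (intro exI conjI allI impI)
  show "(0::real) < 1 / 56" "(1 / 56 :: real) < 800"
    by simp_all
  fix p :: "nat \<Rightarrow> real"
  assume p: "\<forall>\<^sub>F n in sequentially. 1 / real n \<le> p n \<and> p n \<le> 1 - real n powr (-0.99)"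
  define good where "good n = {E. (1 / 56) * real n * ln (1 / p n) / ln (real n) \<le> real (orth_dim n E) \<and>
    real (orth_dim n E) \<le> 800 * real n * ln (1 / p n) / ln (real n)}" for n
  \<comment> \<open>Both largeness conditions hold eventually; in the second the power of
    \<open>n\<close> is \<open>0.01 - 1/400\<close>, which is positive and beats the
    logarithms.\<close>
  have "\<forall>\<^sub>F n in sequentially. 2 \<le> 800 * real n powr 0.01 / ln (real n)"
    by real_asymp
  moreover have "\<forall>\<^sub>F n in sequentially.
      2 * ln (real n) \<le> 400 * real n powr 0.01 / ln (real n) * real n powr (-1 / 400)"
    by real_asymp
  ultimately have lower: "\<forall>\<^sub>F n in sequentially.
      1 - 1 / real n ^ 5 - 1 / real n \<le> measure_pmf.prob (gnp n (p n)) (good n)"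
    using p eventually_ge_at_top[of 2]
  proof eventually_elim
    case (elim n)
    define M where "M = edge_pmf n (p n)"
    define lo where "lo = {f. real (orth_dim n (graph_of n f)) < (1 / 56) * real n * ln (1 / p n) / ln (real n)}"
    define hi where "hi = {f. 800 * real n * ln (1 / p n) / ln (real n) < real (orth_dim n (graph_of n f))}"
    have "0 < 1 / real n" "0 < real n powr (-0.99)"
      using elim by simp_all
    then have "0 < p n" "p n < 1"
      using elim by linarith+
    then have "measure_pmf.prob M lo \<le> 1 / real n ^ 5" "measure_pmf.prob M hi \<le> 1 / real n"
      unfolding M_def lo_def hi_def using elim
      by (intro prob_small_orth_dim_le prob_large_orth_dim_le; simp)+
    moreover have "measure_pmf.prob M (lo \<union> hi) \<le> measure_pmf.prob M lo + measure_pmf.prob M hi"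
      by (intro measure_Un_le) auto
    moreover have "measure_pmf.prob M {f. graph_of n f \<in> good n} = 1 - measure_pmf.prob M (lo \<union> hi)"
    proof -
      have "{f. graph_of n f \<in> good n} = UNIV - (lo \<union> hi)"
        by (auto simp: good_def lo_def hi_def)
      then show ?thesis
        using measure_pmf.prob_compl[of "lo \<union> hi" M] by simp
    qed
    ultimately show ?case
      unfolding prob_gnp M_def by linarith
  qed
  show "(\<lambda>n. measure_pmf.prob (gnp n (p n)) {E. 1 / 56 * real n * ln (1 / p n) / ln (real n) \<le> real (orth_dim n E) \<and>
      real (orth_dim n E) \<le> 800 * real n * ln (1 / p n) / ln (real n)}) \<longlonglongrightarrow> 1"
    unfolding good_def[symmetric]
  \<comment> \<open>The probability lies between the bound \<open>lower\<close>, which tends to 1,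
    and the constant 1.\<close>
  proof (rule tendsto_sandwich[OF lower _ _ tendsto_const])
    show "(\<lambda>n. 1 - 1 / real n ^ 5 - 1 / real n) \<longlonglongrightarrow> 1"
      by real_asymp
  qed (simp add: always_eventually)
qed

end
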